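(* Let $G$ be a countable sofic group. Let $(X,\mu)$ and $(Y,\nu)$ be standard probability spaces. If the Bernoulli actions of $G$ on $(X^G,\mu^G)$ and on $(Y^G,\nu^G)$ are isomorphic, then $H(\mu)=H(\nu)$ (as elements of $[0,+\infty]$).
   Context: A standard probability space is a standard Borel space with a Borel probability measure (atoms allowed). **Sofic group.** $\mathrm{Sym}(d)$ is the permutation group of $\{1,\dots,d\}$. A countable group $G$ is sofic if it admits a sofic approximation sequence, i.e. a sequence of maps (not necessarily homomorphisms) $\sigma_i:G\to\mathrm{Sym}(d_i)$, written $s\mapsto\sigma_{i,s}$, with $d_i$ positive integers, $d_i\to\infty$, such that $\lim_{i\to\infty}\frac1{d_i}|\{k:\sigma_{i,st}(k)=\sigma_{i,s}\sigma_{i,t}(k)\}|=1$ for all $s,t\in G$, and $\lim_{i\to\infty}\frac1{d_i}|\{k:\sigma_{i,s}(k)\neq\sigma_{i,t}(k)\}|=1$ for all distinct $s,t\in G$. **Bernoulli action.** For a standard probability space $(X,\mu)$, $X^G$ carries the product Borel structure and product measure $\mu^G$, and $G$ acts by $g\cdot(x_h)_{h\in G}=(x_{g^{-1}h})_{h\in G}$. **Isomorphism.** Two measure-preserving actions of $G$ on standard probability spaces are isomorphic (conjugate) if there is a measure-preserving Borel bijection between $G$-invariant conull Borel subsets that is $G$-equivariant. **Base entropy.** For a finite measurable partition $\mathcal Q$ of $X$, $H_\mu(\mathcal Q)=-\sum_{Q\in\mathcal Q}\mu(Q)\log\mu(Q)$ (with $0\log0=0$). $H(\mu)\in[0,+\infty]$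 is the supremum of $H_\mu(\mathcal Q)$ over all finite measurable partitions $\mathcal Q$ of $X$; similarly for $H(\nu)$. *)

theory Defs
  imports "HOL-Probability.Probability" "HOL-Algebra.Sym_Groups"
begin

definition standard_borel :: "'a measure \<Rightarrow> bool" where
  "standard_borel M \<longleftrightarrow>
     (\<exists>T. completely_metrizable_space T \<and> second_countable T \<and>
          topspace T = space M \<and> sets M = sigma_sets (space M) {U. openin T U})"

definition standard_prob_space :: "'a measure \<Rightarrow> bool" where
  "standard_prob_space M \<longleftrightarrow> prob_space M \<and> standard_borel M"

definition sofic_approximation ::
    "('g, 'm) monoid_scheme \<Rightarrow> (nat \<Rightarrow> nat) \<Rightarrow> (nat \<Rightarrow> 'g \<Rightarrow> nat \<Rightarrow> nat) \<Rightarrow> bool" where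
  "sofic_approximation G d \<sigma> \<longleftrightarrow>
     (\<forall>i. 0 < d i) \<and> filterlim d at_top sequentially \<and>
     (\<forall>i. \<forall>s\<in>carrier G. \<sigma> i s \<in> carrier (sym_group (d i))) \<and>
     (\<forall>s\<in>carrier G. \<forall>t\<in>carrier G.
        (\<lambda>i. real (card {k\<in>{1..d i}. \<sigma> i (s \<otimes>\<^bsub>G\<^esub> t) k = \<sigma> i s (\<sigma> i t k)}) / real (d i))
          \<longlonglongrightarrow> 1) \<and>
     (\<forall>s\<in>carrier G. \<forall>t\<in>carrier G. s \<noteq> t \<longrightarrow>
        (\<lambda>i. real (card {k\<in>{1..d i}. \<sigma> i s k \<noteq> \<sigma> i t k}) / real (d i)) \<longlonglongrightarrow> 1)"

definition countable_sofic_group :: "('g, 'm) monoid_scheme \<Rightarrow> bool" where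
  "countable_sofic_group G \<longleftrightarrow>
     group G \<and> countable (carrier G) \<and> (\<exists>d \<sigma>. sofic_approximation G d \<sigma>)"

definition bernoulli_space :: "('g, 'm) monoid_scheme \<Rightarrow> 'a measure \<Rightarrow> ('g \<Rightarrow> 'a) measure" where
  "bernoulli_space G M = (\<Pi>\<^sub>M h\<in>carrier G. M)"

definition bernoulli_action ::
    "('g, 'm) monoid_scheme \<Rightarrow> 'g \<Rightarrow> ('g \<Rightarrow> 'a) \<Rightarrow> ('g \<Rightarrow> 'a)" where
  "bernoulli_action G g x = (\<lambda>h\<in>carrier G. x (inv\<^bsub>G\<^esub> g \<otimes>\<^bsub>G\<^esub> h))"

definition invariant_conull ::
    "('g, 'm) monoid_scheme \<Rightarrow> 'a measure \<Rightarrow> ('g \<Rightarrow> 'a \<Rightarrow> 'a) \<Rightarrow> 'a set \<Rightarrow> bool" where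
  "invariant_conull G M \<alpha> A \<longleftrightarrow>
     A \<in> sets M \<and> space M - A \<in> null_sets M \<and> (\<forall>g\<in>carrier G. \<alpha> g ` A = A)"

text \<open>Only the forward map is required to be Borel: between Borel subsets of standard Borel
  spaces the inverse of a Borel bijection is automatically Borel (Lusin-Souslin).\<close>

definition isomorphic_actions ::
    "('g, 'm) monoid_scheme \<Rightarrow> 'a measure \<Rightarrow> ('g \<Rightarrow> 'a \<Rightarrow> 'a) \<Rightarrow>
     'b measure \<Rightarrow> ('g \<Rightarrow> 'b \<Rightarrow> 'b) \<Rightarrow> bool" where
  "isomorphic_actions G M \<alpha> N \<beta> \<longleftrightarrow>
     (\<exists>A B f. invariant_conull G M \<alpha> A \<and> invariant_conull G N \<beta> B \<and>
        bij_betw f A B \<and>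
        f \<in> restrict_space M A \<rightarrow>\<^sub>M restrict_space N B \<and>
        distr (restrict_space M A) (restrict_space N B) f = restrict_space N B \<and>
        (\<forall>g\<in>carrier G. \<forall>x\<in>A. f (\<alpha> g x) = \<beta> g (f x)))"

definition finite_measurable_partition :: "'a measure \<Rightarrow> 'a set set \<Rightarrow> bool" where
  "finite_measurable_partition M P \<longleftrightarrow> finite P \<and> P \<subseteq> sets M \<and> partition_on (space M) P"

definition partition_entropy :: "'a measure \<Rightarrow> 'a set set \<Rightarrow> real" where
  "partition_entropy M P = - (\<Sum>Q\<in>P. measure M Q * ln (measure M Q))"

definition base_entropy :: "'a measure \<Rightarrow> ereal" where
  "base_entropy M = (SUP P\<in>{P. finite_measurable_partition M P}. ereal (partition_entropy M P))"

end

theory Submission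
  imports Defs
begin

text \<open>Identify \<open>X\<^sup>G\<close> and \<open>Y\<^sup>G\<close>, so that a finite label of the \<open>Y\<close>-coordinate at the identity is,
  up to a small error, a function of finitely many finite labels of the \<open>X\<close>-coordinates, and each of
  those is, up to a much smaller error, a function of finitely many \<open>Y\<close>-coordinates.  Now put i.i.d.
  \<open>\<nu>\<close>-distributed variables on the \<open>d\<close> points of a sofic approximation.  The second code produces
  \<open>d\<close> labels whose entropies are nearly that of the label of \<open>X\<close>; the first code recovers from
  them the labels of the \<open>d\<close> variables, up to errors of small entropy.  Subadditivity of Shannon entropy
  and division by \<open>d\<close> give \<open>H(\<nu>) \<le> H(\<mu>)\<close>, and the situation is symmetric.  That the inverse
  of the Borel isomorphism is measurable up to null sets follows from inner regularity.\<close>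

subsection \<open>Shannon entropy of finite-valued functions\<close>

text \<open>A general sofic group has no Folner sets over which to compare the two processes, so the
  comparison takes place on finite models. Only one process is transplanted there. The labels
  computed from the i.i.d. variables need not be independent, but they are only bounded from above,
  by subadditivity, so only their one-site laws matter, and these are exact at most points.
  Independence is needed for one equality: \<open>d\<close> i.i.d. labels have \<open>d\<close>
  times the entropy of one. Errors must be paid for in entropy and not just in probability. Each is
  therefore recorded by a label with a finite range known in advance: 0 for agreement, and otherwise
  the successor of the label to be recovered. Such a label has small entropy once it is 0 with
  probability near 1. This dictates the order of choices: the tolerance of the first code depends on
  the range of \<open>\<psi>\<close>, that of the second also on the length and alphabet of the
  first. Since all labels are finite, infinite base entropy causes no difficulty.\<close>

definition shannon :: "'a measure \<Rightarrow> ('a \<Rightarrow> 'b) \<Rightarrow> real" where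
  "shannon M X = - (\<Sum>c\<in>X ` space M.
     measure M (X -` {c} \<inter> space M) * ln (measure M (X -` {c} \<inter> space M)))"

lemma (in prob_space) information_space_exp: "information_space M (exp 1)"
  by unfold_locales simp

lemma (in prob_space) shannon_eq_entropy:
  assumes "simple_function M X"
  shows "shannon M X = entropy (exp 1) (count_space (X ` space M)) X"
proof -
  interpret information_space M "exp 1" by (rule information_space_exp)
  show ?thesis
    by (subst entropy_simple_distributed[OF simple_distributedI[OF assms measure_nonneg refl]])
       (simp add: shannon_def log_def)
qed

lemma (in prob_space) shannon_data_processing:
  assumes "simple_function M X"
  shows "shannon M (\<lambda>x. f (X x)) \<le> shannon M X"
proof -
  interpret information_space M "exp 1" by (rule information_space_exp)
  show ?thesis
    using entropy_data_processing[OF assms, of f] assms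
    by (simp add: shannon_eq_entropy simple_function_compose comp_def simple_function_compose1)
qed

lemma (in prob_space) shannon_Pair:
  assumes X: "simple_function M X" and Y: "simple_function M Y"
  shows "shannon M (\<lambda>x. (X x, Y x)) \<le> shannon M X + shannon M Y"
proof -
  interpret information_space M "exp 1" by (rule information_space_exp)
  show ?thesis
    using entropy_chain_rule[OF X Y] conditional_entropy_less_eq_entropy[OF Y X]
    by (simp add: shannon_eq_entropy simple_function_Pair X Y)
qed

lemma (in prob_space) shannon_le_ln_card:
  assumes "simple_function M X"
  shows "shannon M X \<le> ln (real (card (X ` space M)))"
proof -
  interpret information_space M "exp 1" by (rule information_space_exp)
  show ?thesis
    using entropy_le_card[OF simple_distributedI[OF assms measure_nonneg refl]]
    by (simp add: shannon_eq_entropy assms log_def)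
qed

text \<open>Unattained values have empty fibres and contribute \<open>0 * ln 0 = 0\<close>. Bounds
  can thus be made uniform over all labels with a fixed finite range.\<close>

lemma (in prob_space) shannon_eq_sum:
  assumes "finite S" "X ` space M \<subseteq> S"
  shows "shannon M X = - (\<Sum>c\<in>S. prob (X -` {c} \<inter> space M) * ln (prob (X -` {c} \<inter> space M)))"
proof -
  have "X -` {c} \<inter> space M = {}" if "c \<notin> X ` space M" for c
    using that by auto
  then show ?thesis
    unfolding shannon_def neg_equal_iff_equal using assms
    by (intro sum.mono_neutral_left) auto
qed

lemma shannon_distr:
  assumes f: "f \<in> M \<rightarrow>\<^sub>M N" and dis: "distr M N f = N"
    and fin: "finite (X ` space N)" and X: "X \<in> N \<rightarrow>\<^sub>M count_space UNIV" and "prob_space M"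
  shows "shannon N X = shannon M (\<lambda>x. X (f x))"
proof -
  interpret prob_space M by fact
  have N: "prob_space N" using prob_space_distr[OF f] dis by simp
  have *: "measure N (X -` {c} \<inter> space N) = measure M ((\<lambda>x. X (f x)) -` {c} \<inter> space M)" for c
  proof -
    have "measure N (X -` {c} \<inter> space N) = measure (distr M N f) (X -` {c} \<inter> space N)"
      by (simp add: dis)
    also have "\<dots> = measure M (f -` (X -` {c} \<inter> space N) \<inter> space M)"
      using X by (intro measure_distr f) (auto intro: measurable_sets)
    also have "f -` (X -` {c} \<inter> space N) \<inter> space M = (\<lambda>x. X (f x)) -` {c} \<inter> space M"
      using measurable_space[OF f] by auto
    finally show ?thesis .
  qed
  show ?thesis
    unfolding prob_space.shannon_eq_sum[OF N fin subset_refl] *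
    by (rule shannon_eq_sum[symmetric]) (use fin measurable_space[OF f] in auto)
qed

text \<open>A finite tuple of labels is kept as an extensional function. Adjoining a coordinate is a
  function of a pair, so binary facts lift by induction.\<close>

lemma simple_function_restrict:
  assumes "finite I" "\<And>i. i \<in> I \<Longrightarrow> simple_function M (X i)"
  shows "simple_function M (\<lambda>x. \<lambda>i\<in>I. X i x)"
  using assms
proof (induction I)
  case empty
  then show ?case by (simp add: restrict_def)
next
  case (insert j I)
  have eq: "(\<lambda>x. \<lambda>i\<in>insert j I. X i x) = (\<lambda>x. (\<lambda>(f, y). f(j := y)) (\<lambda>i\<in>I. X i x, X j x))"
    by (auto simp: fun_eq_iff)
  have "simple_function M (\<lambda>x. (\<lambda>i\<in>I. X i x, X j x))"
    by (intro simple_function_Pair insert.IH insert.prems) auto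
  from simple_function_compose1[OF this, of "\<lambda>(f, y). f(j := y)"] show ?case
    by (simp only: eq)
qed

lemma (in prob_space) shannon_const: "shannon M (\<lambda>_. c) = 0"
  using not_empty prob_space by (simp add: shannon_def image_constant_conv)

lemma (in prob_space) shannon_nonneg:
  assumes "simple_function M X" shows "0 \<le> shannon M X"
  using shannon_data_processing[OF assms, of "\<lambda>_. ()"] by (simp add: shannon_const)

lemma (in prob_space) shannon_restrict:
  assumes "finite I" "\<And>i. i \<in> I \<Longrightarrow> simple_function M (X i)"
  shows "shannon M (\<lambda>x. \<lambda>i\<in>I. X i x) \<le> (\<Sum>i\<in>I. shannon M (X i))"
  using assms
proof (induction I)
  case empty
  then show ?case by (simp add: restrict_def shannon_const)
next
  case (insert j I)
  have *: "(\<lambda>x. \<lambda>i\<in>insert j I. X i x) = (\<lambda>x. (\<lambda>(f, y). f(j := y)) (\<lambda>i\<in>I. X i x, X j x))"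
    by (auto simp: fun_eq_iff)
  have sf: "simple_function M (\<lambda>x. \<lambda>i\<in>I. X i x)"
    using insert by (intro simple_function_restrict) auto
  have "shannon M (\<lambda>x. \<lambda>i\<in>insert j I. X i x) \<le> shannon M (\<lambda>x. (\<lambda>i\<in>I. X i x, X j x))"
    unfolding * using sf insert by (intro shannon_data_processing simple_function_Pair) auto
  also have "\<dots> \<le> shannon M (\<lambda>x. \<lambda>i\<in>I. X i x) + shannon M (X j)"
    using sf insert by (intro shannon_Pair) auto
  also have "\<dots> \<le> (\<Sum>i\<in>insert j I. shannon M (X i))"
    using insert(1,2) insert(3)[OF insert(4)] by (simp del: restrict_apply)
  finally show ?case .
qed

section \<open>Entropy of independent identically distributed labels\<close>

lemma sum_mult_ln_mult:
  fixes a :: "'i \<Rightarrow> real" and b :: "'j \<Rightarrow> real"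
  shows "(\<Sum>i\<in>I. \<Sum>j\<in>J. a i * b j * ln (a i * b j)) =
    (\<Sum>j\<in>J. b j) * (\<Sum>i\<in>I. a i * ln (a i)) + (\<Sum>i\<in>I. a i) * (\<Sum>j\<in>J. b j * ln (b j))"
proof -
  \<comment> \<open>The logarithm is split only for nonzero factors; otherwise every term carries a
    vanishing factor.\<close>
  have *: "a i * b j * ln (a i * b j) = b j * (a i * ln (a i)) + a i * (b j * ln (b j))" for i j
    by (cases "a i = 0 \<or> b j = 0") (auto simp: ln_mult algebra_simps)
  show ?thesis
    unfolding * sum.distrib sum_product
    by (subst sum.swap) simp
qed

text \<open>When one coordinate is split off, the remaining product weights sum to 1, so each
  coordinate contributes its own one-site sum.\<close>

lemma sum_PiE_prod_ln:
  fixes p :: "'c \<Rightarrow> real"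
  assumes "finite I" "finite S" "(\<Sum>c\<in>S. p c) = 1"
  shows "(\<Sum>w\<in>I \<rightarrow>\<^sub>E S. (\<Prod>i\<in>I. p (w i)) * ln (\<Prod>i\<in>I. p (w i))) = real (card I) * (\<Sum>c\<in>S. p c * ln (p c))"
  using assms(1)
proof (induction I)
  case empty
  then show ?case by simp
next
  case (insert j I)
  have one: "(\<Sum>w\<in>I \<rightarrow>\<^sub>E S. \<Prod>i\<in>I. p (w i)) = 1"
    using prod.distrib insert(1) assms prod_sum_PiE[of I "\<lambda>_. S" "\<lambda>_. p"] by simp
  have "(\<Sum>w\<in>insert j I \<rightarrow>\<^sub>E S. (\<Prod>i\<in>insert j I. p (w i)) * ln (\<Prod>i\<in>insert j I. p (w i))) =
    (\<Sum>(c, w)\<in>S \<times> (I \<rightarrow>\<^sub>E S). p c * (\<Prod>i\<in>I. p (w i)) * ln (p c * (\<Prod>i\<in>I. p (w i))))"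
    unfolding PiE_insert_eq
  proof (subst sum.reindex)
    show "inj_on (\<lambda>(y, g). g(j := y)) (S \<times> (I \<rightarrow>\<^sub>E S))"
      using insert(2) by (rule inj_combinator)
    have *: "(\<Prod>i\<in>I. p (if i = j then c else w i)) = (\<Prod>i\<in>I. p (w i))" for c w
      using insert(2) by (intro prod.cong) auto
    show "sum ((\<lambda>w. (\<Prod>i\<in>insert j I. p (w i)) * ln (\<Prod>i\<in>insert j I. p (w i))) \<circ> (\<lambda>(y, g). g(j := y))) (S \<times> (I \<rightarrow>\<^sub>E S)) =
    (\<Sum>(c, w)\<in>S \<times> (I \<rightarrow>\<^sub>E S). p c * (\<Prod>i\<in>I. p (w i)) * ln (p c * (\<Prod>i\<in>I. p (w i))))"
      using insert(1,2) by (intro sum.cong) (auto simp: *)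
  qed
  also have "\<dots> = (\<Sum>c\<in>S. p c * ln (p c)) + real (card I) * (\<Sum>c\<in>S. p c * ln (p c))"
    unfolding sum.cartesian_product[symmetric] sum_mult_ln_mult insert.IH one assms(3) by simp
  finally show ?case using insert(1,2) by (simp add: algebra_simps)
qed

text \<open>Fibres of the tuple are boxes, whose probabilities are products. On the sofic model this
  equality gives the quantity to be bounded; the other joint entropies there are only estimated from
  above.\<close>

lemma shannon_iid:
  assumes N: "prob_space N" and I: "finite I" and X: "simple_function N X"
  shows "shannon (\<Pi>\<^sub>M i\<in>I. N) (\<lambda>w. \<lambda>i\<in>I. X (w i)) = real (card I) * shannon N X"
proof -
  interpret N: prob_space N by fact
  interpret P: prob_space "\<Pi>\<^sub>M i\<in>I. N" using N by (intro prob_space_PiM)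
  interpret F: finite_product_prob_space "\<lambda>_. N" I by unfold_locales fact
  let ?S = "X ` space N"
  let ?p = "\<lambda>c. measure N (X -` {c} \<inter> space N)"
  have fin: "finite ?S" using X by (rule simple_functionD)
  have m: "X -` {c} \<inter> space N \<in> sets N" for c using X by (rule simple_functionD)
  have one: "(\<Sum>c\<in>?S. ?p c) = 1"
  proof -
    have "(\<Sum>c\<in>?S. ?p c) = measure N (\<Union>c\<in>?S. X -` {c} \<inter> space N)"
      using fin m by (intro N.finite_measure_finite_Union[symmetric]) (auto simp: disjoint_family_on_def)
    also have "(\<Union>c\<in>?S. X -` {c} \<inter> space N) = space N" by auto
    finally show ?thesis by (simp add: N.prob_space)
  qed
  have pr: "P.prob ((\<lambda>w. \<lambda>i\<in>I. X (w i)) -` {c} \<inter> space (\<Pi>\<^sub>M i\<in>I. N)) = (\<Prod>i\<in>I. ?p (c i))"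
    if "c \<in> I \<rightarrow>\<^sub>E ?S" for c
  proof -
    have "(\<lambda>w. \<lambda>i\<in>I. X (w i)) -` {c} \<inter> space (\<Pi>\<^sub>M i\<in>I. N) = (\<Pi>\<^sub>E i\<in>I. X -` {c i} \<inter> space N)"
      using that by (auto simp: space_PiM fun_eq_iff PiE_iff extensional_def)
    then show ?thesis using F.prob_times[of "\<lambda>i. X -` {c i} \<inter> space N"] m by simp
  qed
  have "shannon (\<Pi>\<^sub>M i\<in>I. N) (\<lambda>w. \<lambda>i\<in>I. X (w i)) = - (\<Sum>c\<in>I \<rightarrow>\<^sub>E ?S. (\<Prod>i\<in>I. ?p (c i)) * ln (\<Prod>i\<in>I. ?p (c i)))"
    by (subst P.shannon_eq_sum[of "I \<rightarrow>\<^sub>E ?S"])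
       (use I fin pr in \<open>auto intro!: finite_PiE sum.cong simp: space_PiM\<close>)
  also have "\<dots> = real (card I) * shannon N X"
    by (subst sum_PiE_prod_ln[OF I fin one]) (simp add: shannon_def)
  finally show ?thesis .
qed

section \<open>Small entropy near a point mass\<close>

lemma tendsto_x_ln_x: "((\<lambda>x::real. x * ln x) \<longlongrightarrow> 0) (at_right 0)"
  by real_asymp

text \<open>The function \<open>x * ln x\<close> tends to 0 at 0 and at 1, the two weights that
  occur in a point mass.\<close>

lemma small_mult_ln:
  assumes "0 < (\<delta>::real)"
  obtains \<epsilon> where "0 < \<epsilon>" "\<And>x. 0 \<le> x \<Longrightarrow> x \<le> \<epsilon> \<Longrightarrow> - (x * ln x) \<le> \<delta>"
    "\<And>x. 1 - \<epsilon> \<le> x \<Longrightarrow> x \<le> 1 \<Longrightarrow> - (x * ln x) \<le> \<delta>"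
proof -
  have "eventually (\<lambda>x::real. dist (x * ln x) 0 < \<delta>) (at_right 0)"
    using tendsto_x_ln_x assms by (rule tendstoD)
  then obtain b where b: "b > 0" "\<And>x. 0 < x \<Longrightarrow> x < b \<Longrightarrow> \<bar>x * ln x\<bar> < \<delta>"
    unfolding eventually_at_right_field dist_real_def by auto
  have "((\<lambda>x::real. x * ln x) \<longlongrightarrow> 1 * ln 1) (at 1)" by (intro tendsto_intros) auto
  then have "eventually (\<lambda>x::real. dist (x * ln x) 0 < \<delta>) (at 1)"
    using assms by (auto dest!: tendstoD[where e=\<delta>])
  then obtain c where c: "c > 0" "\<And>x. x \<noteq> 1 \<Longrightarrow> \<bar>x - 1\<bar> < c \<Longrightarrow> \<bar>x * ln x\<bar> < \<delta>"
    unfolding eventually_at dist_real_def by auto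
  show ?thesis
  proof (rule that[of "min b c / 2"])
    show "0 < min b c / 2" using b c by simp
    fix x :: real
    show "- (x * ln x) \<le> \<delta>" if "0 \<le> x" "x \<le> min b c / 2"
      using that b c assms by (cases "x = 0") (auto intro!: order.trans[OF _ less_imp_le[OF b(2)[of x]]])
    show "- (x * ln x) \<le> \<delta>" if "1 - min b c / 2 \<le> x" "x \<le> 1"
    proof (cases "x = 1")
      case False
      then have "\<bar>x * ln x\<bar> < \<delta>" using that b(1) c(1) by (intro c(2)) auto
      then show ?thesis by linarith
    qed (use assms in simp)
  qed
qed

text \<open>A weak form of Fano's inequality: all weights are close to 0 except that of
  \<open>z\<close>, which is close to 1. The tolerance does not depend on the probability space or
  on the label, so it can be fixed before a code is chosen.\<close>

lemma small_shannon:
  assumes S: "finite S" and "0 < (\<delta>::real)"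
  obtains \<epsilon> where "0 < \<epsilon>"
    "\<And>(M :: 'a measure) X. \<lbrakk>prob_space M; simple_function M X; X ` space M \<subseteq> S;
       measure M {x\<in>space M. X x \<noteq> z} \<le> \<epsilon>\<rbrakk> \<Longrightarrow> shannon M X \<le> \<delta>"
proof -
  have "0 < \<delta> / (card S + 1)" using assms by simp
  from small_mult_ln[OF this] obtain \<epsilon> where e: "0 < \<epsilon>"
    "\<And>x. 0 \<le> x \<Longrightarrow> x \<le> \<epsilon> \<Longrightarrow> - (x * ln x) \<le> \<delta> / (card S + 1)"
    "\<And>x. 1 - \<epsilon> \<le> x \<Longrightarrow> x \<le> 1 \<Longrightarrow> - (x * ln x) \<le> \<delta> / (card S + 1)" by blast
  show ?thesis
  proof (rule that[OF e(1)])
    fix M :: "'a measure" and X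
    assume M: "prob_space M" and X: "simple_function M X" "X ` space M \<subseteq> S"
      and le: "measure M {x\<in>space M. X x \<noteq> z} \<le> \<epsilon>"
    interpret prob_space M by fact
    have m: "X -` {c} \<inter> space M \<in> sets M" for c using X(1) by (rule simple_functionD)
    have eq: "{x\<in>space M. X x \<noteq> z} = space M - (X -` {z} \<inter> space M)" by auto
    have "- (prob (X -` {c} \<inter> space M) * ln (prob (X -` {c} \<inter> space M))) \<le> \<delta> / (card S + 1)" for c
    proof (cases "c = z")
      case True
      then show ?thesis using le m[of z] unfolding eq by (intro e(3)) (simp_all add: prob_compl)
    next
      case False
      have "prob (X -` {c} \<inter> space M) \<le> prob {x\<in>space M. X x \<noteq> z}"
        using False m[of z] unfolding eq by (intro finite_measure_mono) auto
      with le show ?thesis by (intro e(2)) auto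
    qed
    then have "shannon M X \<le> (\<Sum>c\<in>S. \<delta> / (card S + 1))"
      unfolding shannon_eq_sum[OF S X(2)] sum_negf[symmetric] by (intro sum_mono)
    also have "\<dots> = \<delta> * (card S / (card S + 1))" by simp
    also have "\<dots> \<le> \<delta> * 1" using \<open>0 < \<delta>\<close> by (intro mult_left_mono) (auto simp: field_simps)
    finally show "shannon M X \<le> \<delta>" by simp
  qed
qed

subsection \<open>Independent labellings of a sofic approximation\<close>

lemma card_not_div_tendsto:
  fixes d :: "nat \<Rightarrow> nat"
  assumes "\<And>i. 0 < d i" "(\<lambda>i. real (card {k\<in>{1..d i}. P i k}) / real (d i)) \<longlonglongrightarrow> 1"
  shows "(\<lambda>i. real (card {k\<in>{1..d i}. \<not> P i k}) / real (d i)) \<longlonglongrightarrow> 0"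
proof -
  have "real (card {k\<in>{1..d i}. \<not> P i k}) / real (d i) = 1 - real (card {k\<in>{1..d i}. P i k}) / real (d i)" for i
  proof -
    have "{k\<in>{1..d i}. \<not> P i k} = {1..d i} - {k\<in>{1..d i}. P i k}" by auto
    then have "card {k\<in>{1..d i}. \<not> P i k} = d i - card {k\<in>{1..d i}. P i k}"
      using card_Diff_subset[of "{k\<in>{1..d i}. P i k}" "{1..d i}"] by fastforce
    moreover have "card {k\<in>{1..d i}. P i k} \<le> d i"
      using card_mono[of "{1..d i}" "{k\<in>{1..d i}. P i k}"] by fastforce
    ultimately show ?thesis using assms(1)[of i] by (simp add: of_nat_diff field_simps)
  qed
  with tendsto_diff[OF tendsto_const[of 1] assms(2)] show ?thesis by simp
qed

text \<open>A union bound over the finitely many pairs: finitely many exceptional sets of vanishing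
  density have a union of vanishing density.\<close>

lemma sofic_approximation_good:
  assumes s: "sofic_approximation G d \<sigma>" and F: "finite F" "F \<subseteq> carrier G"
  shows "(\<lambda>i. real (card {k\<in>{1..d i}. \<not> (\<forall>s\<in>F. \<forall>t\<in>F. \<sigma> i (s \<otimes>\<^bsub>G\<^esub> t) k = \<sigma> i s (\<sigma> i t k) \<and>
      (s \<noteq> t \<longrightarrow> \<sigma> i s k \<noteq> \<sigma> i t k))}) / real (d i)) \<longlonglongrightarrow> 0"
proof -
  let ?P = "\<lambda>i s t k. \<sigma> i (s \<otimes>\<^bsub>G\<^esub> t) k = \<sigma> i s (\<sigma> i t k)"
  let ?Q = "\<lambda>i s t k. s \<noteq> t \<longrightarrow> \<sigma> i s k \<noteq> \<sigma> i t k"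
  note conjs = s[unfolded sofic_approximation_def]
  note d = conjs[THEN conjunct1, THEN spec]
  note mul = conjs[THEN conjunct2, THEN conjunct2, THEN conjunct2, THEN conjunct1, THEN bspec, THEN bspec]
  note free = conjs[THEN conjunct2, THEN conjunct2, THEN conjunct2, THEN conjunct2, rule_format]
  have P: "(\<lambda>i. real (card {k\<in>{1..d i}. \<not> ?P i s t k}) / real (d i)) \<longlonglongrightarrow> 0" if "s \<in> F" "t \<in> F" for s t
    using that F by (intro card_not_div_tendsto[OF d] mul) auto
  have Q: "(\<lambda>i. real (card {k\<in>{1..d i}. \<not> ?Q i s t k}) / real (d i)) \<longlonglongrightarrow> 0" if "s \<in> F" "t \<in> F" for s t
  proof (cases "s = t")
    case False
    show ?thesis
      using that F False free by (intro card_not_div_tendsto[OF d]) (simp add: subset_iff)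
  qed simp
  let ?b = "\<lambda>i. \<Sum>(s, t)\<in>F \<times> F. real (card {k\<in>{1..d i}. \<not> ?P i s t k}) / real (d i) +
     real (card {k\<in>{1..d i}. \<not> ?Q i s t k}) / real (d i)"
  have "?b \<longlonglongrightarrow> (\<Sum>(s, t)\<in>F \<times> F. 0 + 0)"
    unfolding split_beta using P Q by (intro tendsto_sum tendsto_add) auto
  then have b: "?b \<longlonglongrightarrow> 0" by simp
  have le: "real (card {k\<in>{1..d i}. \<not> (\<forall>s\<in>F. \<forall>t\<in>F. ?P i s t k \<and> ?Q i s t k)}) / real (d i) \<le> ?b i" for i
  proof -
    have "card {k\<in>{1..d i}. \<not> (\<forall>s\<in>F. \<forall>t\<in>F. ?P i s t k \<and> ?Q i s t k)}
      = card (\<Union>(s, t)\<in>F \<times> F. {k\<in>{1..d i}. \<not> ?P i s t k} \<union> {k\<in>{1..d i}. \<not> ?Q i s t k})"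
      by (rule arg_cong[where f=card]) blast
    also have "\<dots> \<le> (\<Sum>x\<in>F \<times> F. card (case x of (s, t) \<Rightarrow> {k\<in>{1..d i}. \<not> ?P i s t k} \<union> {k\<in>{1..d i}. \<not> ?Q i s t k}))"
      using F by (intro card_UN_le) auto
    also have "\<dots> \<le> (\<Sum>(s, t)\<in>F \<times> F. card {k\<in>{1..d i}. \<not> ?P i s t k} + card {k\<in>{1..d i}. \<not> ?Q i s t k})"
      by (intro sum_mono) (auto intro: card_Un_le)
    finally have "real (card {k\<in>{1..d i}. \<not> (\<forall>s\<in>F. \<forall>t\<in>F. ?P i s t k \<and> ?Q i s t k)}) \<le>
      real (\<Sum>(s, t)\<in>F \<times> F. card {k\<in>{1..d i}. \<not> ?P i s t k} + card {k\<in>{1..d i}. \<not> ?Q i s t k})"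
      by linarith
    also have "\<dots> = d i * ?b i"
      unfolding of_nat_sum sum_distrib_left using d[of i] by (intro sum.cong) (auto simp: distrib_left)
    finally show ?thesis using d[of i] by (simp add: field_simps)
  qed
  show ?thesis
    by (rule tendsto_sandwich[OF _ _ tendsto_const b]) (use le in auto)
qed

lemma ln_card_mono:
  assumes "A \<noteq> {}" "A \<subseteq> B" "finite B"
  shows "ln (real (card A)) \<le> ln (real (card B))"
  using assms card_mono[OF assms(3,2)] finite_subset[OF assms(2,3)]
  by (intro ln_mono) (auto simp: card_gt_0_iff)

section \<open>Coding on a sofic model\<close>

lemma measurable_PiM_reindex:
  assumes "f \<in> I \<rightarrow> K"
  shows "(\<lambda>w. \<lambda>i\<in>I. w (f i)) \<in> (\<Pi>\<^sub>M i\<in>K. N) \<rightarrow>\<^sub>M (\<Pi>\<^sub>M i\<in>I. N)"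
  using assms by (intro measurable_restrict measurable_component_singleton) auto

text \<open>Distinct coordinates are independent, so an injective relabelling preserves the product
  law. At good points of the sofic model, freeness supplies the injection.\<close>

lemma shannon_PiM_reindex:
  assumes N: "prob_space N" and f: "inj_on f I" "f \<in> I \<rightarrow> K" and X: "simple_function (\<Pi>\<^sub>M i\<in>I. N) X"
  shows "shannon (\<Pi>\<^sub>M i\<in>K. N) (\<lambda>w. X (\<lambda>i\<in>I. w (f i))) = shannon (\<Pi>\<^sub>M i\<in>I. N) X"
proof (rule shannon_distr[symmetric])
  show "distr (\<Pi>\<^sub>M i\<in>K. N) (\<Pi>\<^sub>M i\<in>I. N) (\<lambda>w. \<lambda>i\<in>I. w (f i)) = (\<Pi>\<^sub>M i\<in>I. N)"
    using distr_PiM_reindex[of K "\<lambda>_. N" f I] N f by simp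
  show "(\<lambda>w. \<lambda>i\<in>I. w (f i)) \<in> (\<Pi>\<^sub>M i\<in>K. N) \<rightarrow>\<^sub>M (\<Pi>\<^sub>M i\<in>I. N)"
    using f by (intro measurable_PiM_reindex)
qed (use N X in \<open>auto intro!: prob_space_PiM measurable_simple_function simple_functionD(1)\<close>)

text \<open>The parameters \<open>k\<close> and \<open>r\<close> cover three settings: the whole
  group and a finite window in it, both with \<open>r g h = g \<otimes> h\<close>, and the sofic
  model, where \<open>r\<close> composes two of its maps.\<close>

lemma simple_function_decoding_error:
  assumes \<psi>: "simple_function N \<psi>" and \<alpha>: "simple_function (\<Pi>\<^sub>M h\<in>E. N) \<alpha>"
    and F: "finite F" and k: "k \<in> K" and r: "\<And>g h. g \<in> F \<Longrightarrow> h \<in> E \<Longrightarrow> r g h \<in> K"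
  shows "simple_function (\<Pi>\<^sub>M h\<in>K. N)
      (\<lambda>y. if \<psi> (y k) = \<gamma> (\<lambda>g\<in>F. \<alpha> (\<lambda>h\<in>E. y (r g h))) then 0 else Suc (\<psi> (y k)))"
proof -
  have 1: "simple_function (\<Pi>\<^sub>M h\<in>K. N) (\<lambda>y. \<psi> (y k))"
    by (rule simple_function_comp[OF measurable_component_singleton[OF k] \<psi>])
  have "simple_function (\<Pi>\<^sub>M h\<in>K. N) (\<lambda>y. \<lambda>g\<in>F. \<alpha> (\<lambda>h\<in>E. y (r g h)))"
  proof (rule simple_function_restrict[OF F])
    fix g assume "g \<in> F"
    then show "simple_function (\<Pi>\<^sub>M h\<in>K. N) (\<lambda>y. \<alpha> (\<lambda>h\<in>E. y (r g h)))"
      using r by (intro simple_function_comp[OF measurable_PiM_reindex \<alpha>]) auto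
  qed
  from simple_function_compose1[OF simple_function_Pair[OF 1 this],
      where g="\<lambda>(a, b). if a = \<gamma> b then 0 else Suc a"]
  show ?thesis by (simp only: prod.case)
qed

text \<open>Read a configuration \<open>w\<close> on \<open>{1..d}\<close> as an approximate configuration on the group around
  each point \<open>k\<close> by placing \<open>w (\<sigma> (inv h) k)\<close> at \<open>h\<close>.  For an i.i.d. random \<open>w\<close> the labels
  \<open>\<psi> (w k)\<close> are recovered from the \<open>2 d\<close> variables giving \<open>\<alpha>\<close> and the error variable of the
  statement at each \<open>k\<close>, and at most points \<open>k\<close> these have exactly the laws of the statement.\<close>

lemma sofic_shannon_le:
  fixes G (structure) and \<psi> :: "'y \<Rightarrow> nat" and \<alpha> :: "('g \<Rightarrow> 'y) \<Rightarrow> 'c"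
  assumes G: "countable_sofic_group G" and N: "prob_space N"
    and E: "finite E" "E \<subseteq> carrier G" and F: "finite F" "F \<subseteq> carrier G"
    and \<psi>: "simple_function N \<psi>" and \<alpha>: "simple_function (\<Pi>\<^sub>M h\<in>E. N) \<alpha>"
  shows "shannon N \<psi> \<le> shannon (\<Pi>\<^sub>M h\<in>E. N) \<alpha> + shannon (\<Pi>\<^sub>M h\<in>carrier G. N)
    (\<lambda>y. if \<psi> (y \<one>) = \<gamma> (\<lambda>g\<in>F. \<alpha> (\<lambda>h\<in>E. y (g \<otimes> h))) then 0 else Suc (\<psi> (y \<one>)))"
proof -
  interpret group G using G by (simp add: countable_sofic_group_def)
  from G obtain d \<sigma> where sof: "sofic_approximation G d \<sigma>" by (auto simp: countable_sofic_group_def)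
  define Z where "Z = (\<lambda>y. if \<psi> (y \<one>) = \<gamma> (\<lambda>g\<in>F. \<alpha> (\<lambda>h\<in>E. y (g \<otimes> h))) then 0 else Suc (\<psi> (y \<one>)))"
  \<comment> \<open>The coordinates that \<open>Z\<close> reads: \<open>\<one>\<close> for the true
    label, the products for its decoding.\<close>
  define W where "W = insert \<one> ((\<lambda>(g, h). g \<otimes> h) ` (F \<times> E))"
  have W: "finite W" "W \<subseteq> carrier G" and W1: "\<one> \<in> W" using E F by (auto simp: W_def)
  have WFE: "g \<otimes> h \<in> W" if "g \<in> F" "h \<in> E" for g h using that by (auto simp: W_def)
  \<comment> \<open>Inverses, because \<open>s h k\<close> below is defined through
    \<open>inv h\<close>. Distinctness will be used on \<open>W\<close> and \<open>E\<close>,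
    multiplicativity for \<open>E\<close> against \<open>F\<close>, and \<open>\<one>\<close> is
    there so that it can be shown to fix good points.\<close>
  define B where "B = (\<lambda>g. inv g) ` (insert \<one> (W \<union> E \<union> F))"
  have B: "finite B" "B \<subseteq> carrier G" using W E F by (auto simp: B_def)
  define bad where "bad i k \<longleftrightarrow> \<not> (\<forall>s\<in>B. \<forall>t\<in>B. \<sigma> i (s \<otimes> t) k = \<sigma> i s (\<sigma> i t k) \<and> (s \<noteq> t \<longrightarrow> \<sigma> i s k \<noteq> \<sigma> i t k))" for i k
  have lim: "(\<lambda>i. real (card {k\<in>{1..d i}. bad i k}) / real (d i)) \<longlonglongrightarrow> 0"
    unfolding bad_def by (rule sofic_approximation_good[OF sof B])
  \<comment> \<open>At a bad point the laws are unknown, so the entropies are bounded by logarithms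
    of range sizes.\<close>
  define C where "C = ln (card (\<alpha> ` space (\<Pi>\<^sub>M h\<in>E. N))) + ln (card (insert 0 (Suc ` \<psi> ` space N)))"
  let ?h = "shannon (\<Pi>\<^sub>M h\<in>E. N) \<alpha> + shannon (\<Pi>\<^sub>M h\<in>carrier G. N) Z"
  have Nn: "space N \<noteq> {}" using N by (rule prob_space.not_empty)
  have dpos: "0 < d i" for i using sof by (auto simp: sofic_approximation_def)
  have ZW: "simple_function (\<Pi>\<^sub>M h\<in>W. N) Z"
    unfolding Z_def by (rule simple_function_decoding_error[OF \<psi> \<alpha> F(1)]) (use W1 WFE in auto)
  \<comment> \<open>A finite model has room for finitely many coordinates only, so the law of
    \<open>Z\<close> on the whole group is first reduced to \<open>W\<close>.\<close>
  have Zres: "Z y = Z y'" if "\<And>g. g \<in> W \<Longrightarrow> y g = y' g" for y y'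
  proof -
    have 1: "y \<one> = y' \<one>" using that W1 by simp
    have 2: "(\<lambda>g\<in>F. \<alpha> (\<lambda>h\<in>E. y (g \<otimes> h))) = (\<lambda>g\<in>F. \<alpha> (\<lambda>h\<in>E. y' (g \<otimes> h)))"
      using that WFE by (intro restrict_ext arg_cong[where f=\<alpha>]) auto
    show ?thesis unfolding Z_def 1 2 by simp
  qed
  have ZG: "shannon (\<Pi>\<^sub>M h\<in>carrier G. N) Z = shannon (\<Pi>\<^sub>M h\<in>W. N) Z"
  proof -
    have "shannon (\<Pi>\<^sub>M h\<in>carrier G. N) Z = shannon (\<Pi>\<^sub>M h\<in>carrier G. N) (\<lambda>w. Z (\<lambda>i\<in>W. w i))"
      by (rule arg_cong[where f="shannon _"]) (auto intro!: Zres)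
    also have "\<dots> = shannon (\<Pi>\<^sub>M h\<in>W. N) Z"
      using W by (intro shannon_PiM_reindex[where f="\<lambda>i. i"] N ZW) auto
    finally show ?thesis .
  qed
  have ub: "real (d i) * shannon N \<psi> \<le> d i * ?h + card {k\<in>{1..d i}. bad i k} * C" for i
  proof -
    define D where "D = {1..d i}"
    define P where "P = (\<Pi>\<^sub>M k\<in>D. N)"
    interpret P: prob_space P unfolding P_def using N by (intro prob_space_PiM)
    \<comment> \<open>With the inverse, reading at \<open>h\<close> as seen from
      \<open>s g k\<close> becomes reading at \<open>g \<otimes> h\<close> as seen from
      \<open>k\<close>, the order that occurs in \<open>Z\<close>.\<close>
    define s where "s h k = \<sigma> i (inv h) k" for h k
    have perm: "\<sigma> i g permutes {1..d i}" if "g \<in> carrier G" for g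
      using sof[unfolded sofic_approximation_def, THEN conjunct2, THEN conjunct2, THEN conjunct1] that
      by (simp add: sym_group_def)
    have sD: "s h k \<in> D" if "h \<in> carrier G" "k \<in> D" for h k
    proof -
      from permutes_in_image[OF perm[of "inv h"], of k] show ?thesis using that by (simp add: s_def D_def)
    qed
    define A where "A k w = \<alpha> (\<lambda>h\<in>E. w (s h k))" for k w
    \<comment> \<open>0 signals a correct decoding; \<open>Suc\<close> keeps a true label 0 distinct
      from that signal.\<close>
    define Y where "Y k w = (if \<psi> (w k) = \<gamma> (\<lambda>g\<in>F. A (s g k) w) then 0 else Suc (\<psi> (w k)))" for k w
    have sA: "simple_function P (A k)" if "k \<in> D" for k
      unfolding A_def P_def using that sD E by (intro simple_function_comp[OF measurable_PiM_reindex \<alpha>]) auto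
    have sY: "simple_function P (Y k)" if "k \<in> D" for k
      unfolding Y_def P_def A_def using that E F by (intro simple_function_decoding_error \<psi> \<alpha>) (auto intro!: sD)
    have hA: "shannon P (A k) = shannon (\<Pi>\<^sub>M h\<in>E. N) \<alpha>" and hY: "shannon P (Y k) = shannon (\<Pi>\<^sub>M h\<in>carrier G. N) Z"
      if k: "k \<in> D" and good: "\<not> bad i k" for k
    proof -
      have inj: "inj_on (\<lambda>h. s h k) U" if "U \<subseteq> W \<union> E \<union> F" for U
      proof (rule inj_onI, rule ccontr)
        fix g h assume gh: "g \<in> U" "h \<in> U" "s g k = s h k" "g \<noteq> h"
        then have "inv g \<noteq> inv h" using that W E F inv_inv by (metis (no_types, lifting) Un_iff subsetD)
        moreover have "inv g \<in> B" "inv h \<in> B" using gh that by (auto simp: B_def)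
        ultimately show False using good gh by (auto simp: bad_def s_def)
      qed
      show "shannon P (A k) = shannon (\<Pi>\<^sub>M h\<in>E. N) \<alpha>"
        unfolding A_def P_def using k sD E by (intro shannon_PiM_reindex N \<alpha> inj) auto
      \<comment> \<open>Multiplicativity for \<open>\<one> \<otimes> \<one>\<close> says that
        \<open>\<sigma> i \<one>\<close> agrees with its square at \<open>k\<close>, and a
        permutation can be cancelled.\<close>
      have s1: "s \<one> k = k"
      proof -
        have "\<one> \<in> B" by (auto simp: B_def intro!: image_eqI[of _ _ \<one>])
        then have *: "\<sigma> i (\<one> \<otimes> \<one>) k = \<sigma> i \<one> (\<sigma> i \<one> k)" using good unfolding bad_def by blast
        have "inj (\<sigma> i \<one>)" by (rule permutes_inj[OF perm]) simp
        with * show ?thesis by (simp add: s_def inj_def)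
      qed
      have s2: "s h (s g k) = s (g \<otimes> h) k" if gh: "g \<in> F" "h \<in> E" for g h
      proof -
        have "inv h \<in> B" "inv g \<in> B" using gh by (auto simp: B_def)
        then have "\<sigma> i (inv h \<otimes> inv g) k = \<sigma> i (inv h) (\<sigma> i (inv g) k)" using good by (auto simp: bad_def)
        moreover have "inv h \<otimes> inv g = inv (g \<otimes> h)" using gh E F by (simp add: inv_mult_group subsetD)
        ultimately show ?thesis by (simp add: s_def)
      qed
      have YZ: "Y k w = Z (\<lambda>g\<in>W. w (s g k))" for w
      proof -
        have "(\<lambda>g\<in>F. A (s g k) w) = (\<lambda>g\<in>F. \<alpha> (\<lambda>h\<in>E. (\<lambda>g\<in>W. w (s g k)) (g \<otimes> h)))"
          unfolding A_def using s2 WFE by (intro restrict_ext arg_cong[where f=\<alpha>]) auto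
        then show ?thesis using s1 W1 by (simp add: Y_def Z_def)
      qed
      show "shannon P (Y k) = shannon (\<Pi>\<^sub>M h\<in>carrier G. N) Z"
        unfolding ZG YZ P_def using k sD W by (intro shannon_PiM_reindex N ZW inj) auto
    qed
    have hC: "shannon P (A k) + shannon P (Y k) \<le> C" if k: "k \<in> D" for k
    proof -
      have "shannon P (A k) \<le> ln (card (A k ` space P))" by (rule P.shannon_le_ln_card[OF sA[OF k]])
      also have "\<dots> \<le> ln (card (\<alpha> ` space (\<Pi>\<^sub>M h\<in>E. N)))"
      proof -
        have "A k ` space P \<subseteq> \<alpha> ` space (\<Pi>\<^sub>M h\<in>E. N)"
          using k sD E by (auto simp: A_def P_def space_PiM PiE_iff intro!: imageI)
        moreover have "finite (\<alpha> ` space (\<Pi>\<^sub>M h\<in>E. N))" using \<alpha> by (rule simple_functionD)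
        ultimately show ?thesis by (intro ln_card_mono) (auto simp: P.not_empty)
      qed
      finally have 1: "shannon P (A k) \<le> ln (card (\<alpha> ` space (\<Pi>\<^sub>M h\<in>E. N)))" .
      have "shannon P (Y k) \<le> ln (card (Y k ` space P))" by (rule P.shannon_le_ln_card[OF sY[OF k]])
      also have "\<dots> \<le> ln (card (insert 0 (Suc ` \<psi> ` space N)))"
      proof -
        have "Y k ` space P \<subseteq> insert 0 (Suc ` \<psi> ` space N)"
          using k by (auto simp: Y_def P_def space_PiM PiE_iff)
        moreover have "finite (insert 0 (Suc ` \<psi> ` space N))" using simple_functionD(1)[OF \<psi>] by simp
        ultimately show ?thesis by (intro ln_card_mono) (auto simp: P.not_empty)
      qed
      finally show ?thesis using 1 by (simp add: C_def)
    qed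
    \<comment> \<open>Nonnegativity allows a bad point to be charged \<open>?h + C\<close>, so that
      \<open>?h\<close> is summed over all points.\<close>
    have h0: "0 \<le> ?h"
      using simple_functionD ZG prob_space.shannon_nonneg[OF prob_space_PiM \<alpha>] prob_space.shannon_nonneg[OF prob_space_PiM ZW] N
      by simp
    \<comment> \<open>The decoder: where the error label is 0, the code is applied to the first
      components at the neighbours \<open>s g k\<close>; elsewhere the error label itself reveals
      the value.\<close>
    define \<Phi> where "\<Phi> v = (\<lambda>k\<in>D. if snd (v k) = 0 then \<gamma> (\<lambda>g\<in>F. fst (v (s g k))) else snd (v k) - 1)"
      for v :: "nat \<Rightarrow> 'c \<times> nat"
    have rec: "(\<lambda>k\<in>D. \<psi> (w k)) = \<Phi> (\<lambda>k\<in>D. (A k w, Y k w))" for w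
    proof -
      have eq: "(\<lambda>g\<in>F. fst ((\<lambda>k\<in>D. (A k w, Y k w)) (s g k))) = (\<lambda>g\<in>F. A (s g k) w)" if "k \<in> D" for k
        using sD F that by (intro restrict_ext) auto
      show ?thesis
        unfolding \<Phi>_def
      proof (rule restrict_ext)
        fix k assume k: "k \<in> D"
        show "\<psi> (w k) = (if snd ((\<lambda>k\<in>D. (A k w, Y k w)) k) = 0
            then \<gamma> (\<lambda>g\<in>F. fst ((\<lambda>k\<in>D. (A k w, Y k w)) (s g k)))
            else snd ((\<lambda>k\<in>D. (A k w, Y k w)) k) - 1)"
          unfolding eq[OF k] using k by (simp add: Y_def)
      qed
    qed
    have "d i * shannon N \<psi> = shannon P (\<lambda>w. \<lambda>k\<in>D. \<psi> (w k))"
      unfolding P_def by (subst shannon_iid[OF N _ \<psi>]) (auto simp: D_def)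
    also have "\<dots> \<le> shannon P (\<lambda>w. \<lambda>k\<in>D. (A k w, Y k w))"
      unfolding rec using sA sY
      by (intro P.shannon_data_processing simple_function_restrict simple_function_Pair) (auto simp: D_def)
    also have "\<dots> \<le> (\<Sum>k\<in>D. shannon P (\<lambda>w. (A k w, Y k w)))"
      using sA sY by (intro P.shannon_restrict simple_function_Pair) (auto simp: D_def)
    also have "\<dots> \<le> (\<Sum>k\<in>D. shannon P (A k) + shannon P (Y k))"
      using sA sY by (intro sum_mono P.shannon_Pair) auto
    also have "\<dots> \<le> (\<Sum>k\<in>D. ?h + (if bad i k then C else 0))"
      using hA hY hC h0 by (intro sum_mono) force
    also have "\<dots> = d i * ?h + card {k\<in>{1..d i}. bad i k} * C"
      by (simp add: sum.distrib D_def sum.If_cases Int_def)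
    finally show ?thesis .
  qed
  have "shannon N \<psi> \<le> ?h + real (card {k\<in>{1..d i}. bad i k}) / real (d i) * C" for i
    using ub[of i] dpos[of i] by (simp add: field_simps)
  moreover have "(\<lambda>i. ?h + real (card {k\<in>{1..d i}. bad i k}) / real (d i) * C) \<longlonglongrightarrow> ?h + 0 * C"
    by (intro tendsto_intros lim)
  ultimately have "shannon N \<psi> \<le> ?h + 0 * C"
    by (intro LIMSEQ_le_const) auto
  then show ?thesis by (simp add: Z_def)
qed

subsection \<open>Approximation by finitely many discretised coordinates\<close>

text \<open>One label \<open>\<rho>\<close> serves all coordinates, so the entropy per site to be
  compared later is that of this label alone. Natural numbers give all labels a common type.\<close>

definition cyl_approx :: "'o measure \<Rightarrow> 'g set \<Rightarrow> 'x measure \<Rightarrow> ('o \<Rightarrow> 'g \<Rightarrow> 'x) \<Rightarrow> ('o \<Rightarrow> 'b) \<Rightarrow> bool" where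
  "cyl_approx M I N w b \<longleftrightarrow> (\<forall>\<epsilon>>0. \<exists>F (\<rho> :: 'x \<Rightarrow> nat) \<gamma>. finite F \<and> F \<subseteq> I \<and> simple_function N \<rho> \<and>
     measure M {\<omega>\<in>space M. b \<omega> \<noteq> \<gamma> (\<lambda>h\<in>F. \<rho> (w \<omega> h))} < \<epsilon>)"

lemma simple_function_Collect:
  assumes "simple_function M X" shows "{x\<in>space M. P (X x)} \<in> sets M"
proof -
  have "X -` {c. P c} \<inter> space M \<in> sets M"
    using measurable_simple_function[OF assms] by (rule measurable_sets) simp
  also have "X -` {c. P c} \<inter> space M = {x\<in>space M. P (X x)}" by auto
  finally show ?thesis .
qed

lemma simple_function_Collect_neq:
  assumes "simple_function M X" "simple_function M Y" shows "{x\<in>space M. X x \<noteq> Y x} \<in> sets M"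
  using simple_function_Collect[OF simple_function_Pair[OF assms], of "\<lambda>(a, b). a \<noteq> b"] by simp

lemma simple_function_bool:
  assumes "A \<in> sets M" shows "simple_function M (\<lambda>x. x \<in> A)"
proof -
  have "(\<lambda>x. x \<in> A) -` {b} \<inter> space M = (if b then A else space M - A)" for b
    using sets.sets_into_space[OF assms] by (cases b) auto
  then have "(\<lambda>x. x \<in> A) -` {b} \<inter> space M \<in> sets M" for b
    using assms by simp
  then show ?thesis by (auto simp: simple_function_def)
qed

lemma simple_function_cyl:
  assumes "w \<in> M \<rightarrow>\<^sub>M (\<Pi>\<^sub>M h\<in>I. N)" "finite F" "F \<subseteq> I" "simple_function N \<rho>"
  shows "simple_function M (\<lambda>\<omega>. \<lambda>h\<in>F. \<rho> (w \<omega> h))"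
proof (rule simple_function_restrict[OF assms(2)])
  fix h assume "h \<in> F"
  then have "(\<lambda>\<omega>. w \<omega> h) \<in> M \<rightarrow>\<^sub>M N"
    using assms by (intro measurable_compose[OF assms(1) measurable_component_singleton]) auto
  then show "simple_function M (\<lambda>\<omega>. \<rho> (w \<omega> h))" by (rule simple_function_comp) fact
qed

lemma cyl_approxE:
  fixes w :: "'o \<Rightarrow> 'g \<Rightarrow> 'x"
  assumes "cyl_approx M I N w b" "0 < \<epsilon>"
  obtains F and \<rho> :: "'x \<Rightarrow> nat" and \<gamma> where "finite F" "F \<subseteq> I" "simple_function N \<rho>"
    "measure M {\<omega>\<in>space M. b \<omega> \<noteq> \<gamma> (\<lambda>h\<in>F. \<rho> (w \<omega> h))} < \<epsilon>"
  using assms(1)[unfolded cyl_approx_def, rule_format, OF assms(2)]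
  by (elim exE conjE) (rule that)

lemma cyl_approx_cong:
  fixes w :: "'o \<Rightarrow> 'g \<Rightarrow> 'x"
  assumes "\<And>\<omega>. \<omega> \<in> space M \<Longrightarrow> b \<omega> = b' \<omega>"
  shows "cyl_approx M I N w b \<longleftrightarrow> cyl_approx M I N w b'"
proof -
  have "{\<omega>\<in>space M. b \<omega> \<noteq> \<gamma> (\<lambda>h\<in>F. \<rho> (w \<omega> h))} = {\<omega>\<in>space M. b' \<omega> \<noteq> \<gamma> (\<lambda>h\<in>F. \<rho> (w \<omega> h))}"
    for F and \<rho> :: "'x \<Rightarrow> nat" and \<gamma>
    using assms by (intro Collect_cong) (auto simp del: restrict_apply)
  then show ?thesis unfolding cyl_approx_def by (simp only:)
qed

lemma cyl_approx_const: "cyl_approx M I N w (\<lambda>_. c)"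
  unfolding cyl_approx_def
proof (intro allI impI)
  fix \<epsilon> :: real assume "0 < \<epsilon>"
  then have "finite {} \<and> {} \<subseteq> I \<and> simple_function N (\<lambda>_. 0 :: nat) \<and>
      measure M {\<omega>\<in>space M. c \<noteq> (\<lambda>_. c) (\<lambda>h\<in>{}. (\<lambda>_. 0 :: nat) (w \<omega> h))} < \<epsilon>"
    by simp
  then show "\<exists>F (\<rho> :: _ \<Rightarrow> nat) \<gamma>. finite F \<and> F \<subseteq> I \<and> simple_function N \<rho> \<and>
      measure M {\<omega>\<in>space M. c \<noteq> \<gamma> (\<lambda>h\<in>F. \<rho> (w \<omega> h))} < \<epsilon>"
    by (intro exI)
qed

context prob_space
begin

lemma cyl_approx_Pair:
  fixes w :: "'a \<Rightarrow> 'g \<Rightarrow> 'x"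
  assumes w: "w \<in> M \<rightarrow>\<^sub>M (\<Pi>\<^sub>M h\<in>I. N)"
    and s: "simple_function M b" "simple_function M b'"
    and a: "cyl_approx M I N w b" "cyl_approx M I N w b'"
  shows "cyl_approx M I N w (\<lambda>\<omega>. (b \<omega>, b' \<omega>))"
  unfolding cyl_approx_def
proof (intro allI impI)
  fix \<epsilon> :: real assume "0 < \<epsilon>"
  then have e: "0 < \<epsilon> / 2" by simp
  obtain F :: "'g set" and \<rho> :: "'x \<Rightarrow> nat" and \<gamma> where 1: "finite F" "F \<subseteq> I" "simple_function N \<rho>"
    "prob {\<omega>\<in>space M. b \<omega> \<noteq> \<gamma> (\<lambda>h\<in>F. \<rho> (w \<omega> h))} < \<epsilon> / 2"
    by (rule cyl_approxE[OF a(1) e])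
  obtain F' :: "'g set" and \<rho>' :: "'x \<Rightarrow> nat" and \<gamma>' where 2: "finite F'" "F' \<subseteq> I" "simple_function N \<rho>'"
    "prob {\<omega>\<in>space M. b' \<omega> \<noteq> \<gamma>' (\<lambda>h\<in>F'. \<rho>' (w \<omega> h))} < \<epsilon> / 2"
    by (rule cyl_approxE[OF a(2) e])
  \<comment> \<open>Pairing of naturals merges two labels into one, and the union of the coordinate
    sets serves both codes.\<close>
  let ?\<rho> = "\<lambda>x. prod_encode (\<rho> x, \<rho>' x)"
  let ?\<gamma> = "\<lambda>c. (\<gamma> (\<lambda>h\<in>F. fst (prod_decode (c h))), \<gamma>' (\<lambda>h\<in>F'. snd (prod_decode (c h))))"
  have eq: "?\<gamma> (\<lambda>h\<in>F \<union> F'. ?\<rho> (w \<omega> h)) = (\<gamma> (\<lambda>h\<in>F. \<rho> (w \<omega> h)), \<gamma>' (\<lambda>h\<in>F'. \<rho>' (w \<omega> h)))" for \<omega>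
    by (intro arg_cong2[where f=Pair] arg_cong[where f=\<gamma>] arg_cong[where f=\<gamma>'] restrict_ext) auto
  have "prob {\<omega>\<in>space M. (b \<omega>, b' \<omega>) \<noteq> ?\<gamma> (\<lambda>h\<in>F \<union> F'. ?\<rho> (w \<omega> h))} \<le>
     prob ({\<omega>\<in>space M. b \<omega> \<noteq> \<gamma> (\<lambda>h\<in>F. \<rho> (w \<omega> h))} \<union> {\<omega>\<in>space M. b' \<omega> \<noteq> \<gamma>' (\<lambda>h\<in>F'. \<rho>' (w \<omega> h))})"
    unfolding eq using 1 2 w s
    by (intro finite_measure_mono sets.Un simple_function_Collect_neq
        simple_function_compose1[OF simple_function_cyl]) auto
  also have "\<dots> \<le> prob {\<omega>\<in>space M. b \<omega> \<noteq> \<gamma> (\<lambda>h\<in>F. \<rho> (w \<omega> h))} + prob {\<omega>\<in>space M. b' \<omega> \<noteq> \<gamma>' (\<lambda>h\<in>F'. \<rho>' (w \<omega> h))}"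
    using 1 2 w s
    by (intro measure_Un_le simple_function_Collect_neq simple_function_compose1[OF simple_function_cyl]) auto
  also have "\<dots> < \<epsilon>" using 1 2 by simp
  finally show "\<exists>F (\<rho> :: 'x \<Rightarrow> nat) \<gamma>. finite F \<and> F \<subseteq> I \<and> simple_function N \<rho> \<and>
     prob {\<omega>\<in>space M. (b \<omega>, b' \<omega>) \<noteq> \<gamma> (\<lambda>h\<in>F. \<rho> (w \<omega> h))} < \<epsilon>"
    using 1 2 simple_function_compose1[OF simple_function_Pair[OF 1(3) 2(3)], of prod_encode]
    by (intro exI[of _ "F \<union> F'"] exI[of _ ?\<rho>] exI[of _ ?\<gamma>]) simp
qed

lemma cyl_approx_comp:
  fixes w :: "'a \<Rightarrow> 'g \<Rightarrow> 'x"
  assumes w: "w \<in> M \<rightarrow>\<^sub>M (\<Pi>\<^sub>M h\<in>I. N)" and s: "simple_function M b" and a: "cyl_approx M I N w b"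
  shows "cyl_approx M I N w (\<lambda>\<omega>. f (b \<omega>))"
  unfolding cyl_approx_def
proof (intro allI impI)
  fix \<epsilon> :: real assume e: "0 < \<epsilon>"
  obtain F :: "'g set" and \<rho> :: "'x \<Rightarrow> nat" and \<gamma> where 1: "finite F" "F \<subseteq> I" "simple_function N \<rho>"
    "prob {\<omega>\<in>space M. b \<omega> \<noteq> \<gamma> (\<lambda>h\<in>F. \<rho> (w \<omega> h))} < \<epsilon>"
    by (rule cyl_approxE[OF a e])
  have "prob {\<omega>\<in>space M. f (b \<omega>) \<noteq> f (\<gamma> (\<lambda>h\<in>F. \<rho> (w \<omega> h)))} \<le> prob {\<omega>\<in>space M. b \<omega> \<noteq> \<gamma> (\<lambda>h\<in>F. \<rho> (w \<omega> h))}"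
    using 1 w s by (intro finite_measure_mono simple_function_Collect_neq
        simple_function_compose1[OF simple_function_cyl]) auto
  with 1 show "\<exists>F (\<rho> :: 'x \<Rightarrow> nat) \<gamma>. finite F \<and> F \<subseteq> I \<and> simple_function N \<rho> \<and>
     prob {\<omega>\<in>space M. f (b \<omega>) \<noteq> \<gamma> (\<lambda>h\<in>F. \<rho> (w \<omega> h))} < \<epsilon>"
    by (intro exI[of _ F] exI[of _ \<rho>] exI[of _ "\<lambda>c. f (\<gamma> c)"]) simp
qed

text \<open>The triangle inequality for the probability of disagreement: approximability survives
  limits in measure.\<close>

lemma cyl_approx_limit:
  fixes w :: "'a \<Rightarrow> 'g \<Rightarrow> 'x"
  assumes w: "w \<in> M \<rightarrow>\<^sub>M (\<Pi>\<^sub>M h\<in>I. N)" and s: "simple_function M b"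
    and ex: "\<And>\<epsilon>. 0 < \<epsilon> \<Longrightarrow> \<exists>b'. simple_function M b' \<and> cyl_approx M I N w b' \<and> prob {\<omega>\<in>space M. b \<omega> \<noteq> b' \<omega>} < \<epsilon>"
  shows "cyl_approx M I N w b"
  unfolding cyl_approx_def
proof (intro allI impI)
  fix \<epsilon> :: real assume "0 < \<epsilon>"
  then have e: "0 < \<epsilon> / 2" by simp
  from ex[OF e] obtain b' where b': "simple_function M b'" "cyl_approx M I N w b'" "prob {\<omega>\<in>space M. b \<omega> \<noteq> b' \<omega>} < \<epsilon> / 2"
    by blast
  obtain F :: "'g set" and \<rho> :: "'x \<Rightarrow> nat" and \<gamma> where 1: "finite F" "F \<subseteq> I" "simple_function N \<rho>"
    "prob {\<omega>\<in>space M. b' \<omega> \<noteq> \<gamma> (\<lambda>h\<in>F. \<rho> (w \<omega> h))} < \<epsilon> / 2"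
    by (rule cyl_approxE[OF b'(2) e])
  have "prob {\<omega>\<in>space M. b \<omega> \<noteq> \<gamma> (\<lambda>h\<in>F. \<rho> (w \<omega> h))} \<le>
     prob ({\<omega>\<in>space M. b \<omega> \<noteq> b' \<omega>} \<union> {\<omega>\<in>space M. b' \<omega> \<noteq> \<gamma> (\<lambda>h\<in>F. \<rho> (w \<omega> h))})"
    using 1 w s b' by (intro finite_measure_mono sets.Un simple_function_Collect_neq
        simple_function_compose1[OF simple_function_cyl]) auto
  also have "\<dots> \<le> prob {\<omega>\<in>space M. b \<omega> \<noteq> b' \<omega>} + prob {\<omega>\<in>space M. b' \<omega> \<noteq> \<gamma> (\<lambda>h\<in>F. \<rho> (w \<omega> h))}"
    using 1 w s b' by (intro measure_Un_le simple_function_Collect_neq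
        simple_function_compose1[OF simple_function_cyl]) auto
  also have "\<dots> < \<epsilon>" using 1 b' by simp
  finally show "\<exists>F (\<rho> :: 'x \<Rightarrow> nat) \<gamma>. finite F \<and> F \<subseteq> I \<and> simple_function N \<rho> \<and>
     prob {\<omega>\<in>space M. b \<omega> \<noteq> \<gamma> (\<lambda>h\<in>F. \<rho> (w \<omega> h))} < \<epsilon>"
    using 1 by (intro exI[of _ F] exI[of _ \<rho>] exI[of _ \<gamma>]) simp
qed

lemma simple_function_in_vimage:
  assumes "w \<in> M \<rightarrow>\<^sub>M K" "B \<in> sets K"
  shows "simple_function M (\<lambda>\<omega>. w \<omega> \<in> B)"
  by (rule simple_function_comp[OF assms(1) simple_function_bool[OF assms(2)]])

text \<open>Induction over the generated sigma-algebra: one-coordinate events are exact codes,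
  complements and finite unions are functions of codes, and a countable union is the limit in
  measure of its finite parts.\<close>

lemma cyl_approx_vimage:
  fixes w :: "'a \<Rightarrow> 'g \<Rightarrow> 'x"
  assumes w: "w \<in> M \<rightarrow>\<^sub>M (\<Pi>\<^sub>M h\<in>I. N)" and B: "B \<in> sets (\<Pi>\<^sub>M h\<in>I. N)"
  shows "cyl_approx M I N w (\<lambda>\<omega>. w \<omega> \<in> B)"
proof -
  have *: "sets (\<Pi>\<^sub>M h\<in>I. N) = sigma_sets (\<Pi>\<^sub>E i\<in>I. space N)
      {{f \<in> \<Pi>\<^sub>E i\<in>I. space N. f i \<in> A} |i A. i \<in> I \<and> A \<in> sets N}"
    by (rule sets_PiM_single)
  note wsp = measurable_space[OF w, unfolded space_PiM]
  from B show ?thesis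
    unfolding *
  proof (induction B)
    case (Basic a)
    then obtain i A where i: "i \<in> I" "A \<in> sets N" and a: "a = {f \<in> \<Pi>\<^sub>E i\<in>I. space N. f i \<in> A}" by blast
    let ?\<rho> = "\<lambda>x. if x \<in> A then 1 else (0::nat)"
    have \<rho>: "simple_function N ?\<rho>"
      using simple_function_compose1[OF simple_function_bool[OF i(2)], of "\<lambda>b. if b then 1 else 0"] by simp
    have eq: "{\<omega>\<in>space M. (w \<omega> \<in> a) \<noteq> ((\<lambda>h\<in>{i}. ?\<rho> (w \<omega> h)) i = 1)} = {}"
      using wsp by (auto simp: a)
    show ?case
      unfolding cyl_approx_def
    proof (intro allI impI exI[of _ "{i}"] exI[of _ ?\<rho>] exI[of _ "\<lambda>c. c i = 1"] conjI)
      fix \<epsilon> :: real assume "0 < \<epsilon>"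
      then show "prob {\<omega>\<in>space M. (w \<omega> \<in> a) \<noteq> ((\<lambda>h\<in>{i}. ?\<rho> (w \<omega> h)) i = 1)} < \<epsilon>"
        by (simp only: eq measure_empty)
    qed (use i \<rho> in simp_all)
  next
    case Empty
    show ?case by (simp add: cyl_approx_const)
  next
    case (Compl a)
    have "a \<in> sets (\<Pi>\<^sub>M h\<in>I. N)" using Compl.hyps unfolding * .
    then have "cyl_approx M I N w (\<lambda>\<omega>. \<not> (w \<omega> \<in> a))"
      by (intro cyl_approx_comp[OF w _ Compl.IH] simple_function_in_vimage[OF w])
    then show ?case
      by (subst cyl_approx_cong[where b'="\<lambda>\<omega>. \<not> (w \<omega> \<in> a)"]) (use wsp in auto)
  next
    case (Union a)
    have a: "a i \<in> sets (\<Pi>\<^sub>M h\<in>I. N)" for i using Union(1) * by auto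
    have sim: "simple_function M (\<lambda>\<omega>. w \<omega> \<in> (\<Union>i<n. a i))" for n
      using a by (intro simple_function_in_vimage[OF w]) auto
    have fin: "cyl_approx M I N w (\<lambda>\<omega>. w \<omega> \<in> (\<Union>i<n. a i))" for n
    proof (induction n)
      case 0
      then show ?case by (simp add: cyl_approx_const)
    next
      case (Suc n)
      have "cyl_approx M I N w (\<lambda>\<omega>. (w \<omega> \<in> (\<Union>i<n. a i), w \<omega> \<in> a n))"
        using sim Suc Union a by (intro cyl_approx_Pair[OF w] simple_function_in_vimage[OF w]) auto
      from cyl_approx_comp[OF w _ this, of "\<lambda>(p, q). p \<or> q"]
      have "cyl_approx M I N w (\<lambda>\<omega>. w \<omega> \<in> (\<Union>i<n. a i) \<or> w \<omega> \<in> a n)"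
        using sim simple_function_in_vimage[OF w a] by (simp add: simple_function_Pair)
      then show ?case by (simp add: lessThan_Suc disj_commute)
    qed
    show ?case
    proof (rule cyl_approx_limit[OF w])
      show "simple_function M (\<lambda>\<omega>. w \<omega> \<in> (\<Union>i. a i))"
        using a by (intro simple_function_in_vimage[OF w]) auto
      fix \<epsilon> :: real assume "0 < \<epsilon>"
      define D where "D n = {\<omega>\<in>space M. (w \<omega> \<in> (\<Union>i. a i)) \<noteq> (w \<omega> \<in> (\<Union>i<n. a i))}" for n
      have Dm: "D n \<in> sets M" for n
        unfolding D_def using a
        by (intro simple_function_Collect_neq simple_function_in_vimage[OF w]) auto
      have "(\<lambda>n. prob (D n)) \<longlonglongrightarrow> prob (\<Inter>n. D n)"
        using Dm by (intro finite_Lim_measure_decseq) (auto simp: D_def decseq_def)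
      moreover have "(\<Inter>n. D n) = {}"
        unfolding D_def by auto
      ultimately have "(\<lambda>n. prob (D n)) \<longlonglongrightarrow> 0" by simp
      then have "eventually (\<lambda>n. prob (D n) < \<epsilon>) sequentially"
        using \<open>0 < \<epsilon>\<close> by (rule order_tendstoD)
      then obtain n where "prob (D n) < \<epsilon>" by (auto simp: eventually_sequentially)
      then show "\<exists>b'. simple_function M b' \<and> cyl_approx M I N w b' \<and> prob {\<omega>\<in>space M. (w \<omega> \<in> (\<Union>i. a i)) \<noteq> b' \<omega>} < \<epsilon>"
        using sim[of n] fin[of n] unfolding D_def by blast
    qed
  qed
qed

text \<open>A bounded label is assembled from its level events one at a time:
  \<open>min (Suc n) (b \<omega>)\<close> is determined by \<open>min n (b \<omega>)\<close> and the
  truth of \<open>Suc n \<le> b \<omega>\<close>.\<close>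

lemma cyl_approx_nat:
  fixes b :: "'a \<Rightarrow> nat"
  assumes w: "w \<in> M \<rightarrow>\<^sub>M (\<Pi>\<^sub>M h\<in>I. N)" and s: "simple_function M b"
    and a: "\<And>n. cyl_approx M I N w (\<lambda>\<omega>. n \<le> b \<omega>)"
  shows "cyl_approx M I N w b"
proof -
  have m: "cyl_approx M I N w (\<lambda>\<omega>. min n (b \<omega>))" for n
  proof (induction n)
    case 0
    then show ?case by (simp add: cyl_approx_const)
  next
    case (Suc n)
    have sm: "simple_function M (\<lambda>\<omega>. min n (b \<omega>))" "simple_function M (\<lambda>\<omega>. Suc n \<le> b \<omega>)"
      using s by (rule simple_function_compose1)+
    have "cyl_approx M I N w (\<lambda>\<omega>. (\<lambda>(p, q). if q then Suc n else p) (min n (b \<omega>), Suc n \<le> b \<omega>))"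
      by (rule cyl_approx_comp[OF w simple_function_Pair[OF sm] cyl_approx_Pair[OF w sm Suc.IH a]])
    moreover have "(\<lambda>(p, q). if q then Suc n else p) (min n (b \<omega>), Suc n \<le> b \<omega>) = min (Suc n) (b \<omega>)" for \<omega>
      by auto
    ultimately show ?case by simp
  qed
  have "finite (b ` space M)" using s by (rule simple_functionD)
  then obtain n where "\<And>\<omega>. \<omega> \<in> space M \<Longrightarrow> b \<omega> \<le> n"
    by (meson finite_nat_set_iff_bounded_le imageI)
  with m[of n] show ?thesis by (subst cyl_approx_cong[where b'="\<lambda>\<omega>. min n (b \<omega>)"]) (simp_all add: min.absorb2)
qed

end

subsection \<open>Inner regularity of product measures\<close>

definition inner_approx :: "'a measure \<Rightarrow> 'a set set \<Rightarrow> 'a set \<Rightarrow> bool" where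
  "inner_approx M \<C> A \<longleftrightarrow> (\<forall>\<epsilon>>0. \<exists>C\<in>\<C>. C \<subseteq> A \<and> measure M (A - C) < \<epsilon>)"

lemma inner_approxE:
  assumes "inner_approx M \<C> A" "0 < \<epsilon>"
  obtains C where "C \<in> \<C>" "C \<subseteq> A" "measure M (A - C) < \<epsilon>"
  using assms unfolding inner_approx_def by blast

lemma inner_approx_self: "A \<in> \<C> \<Longrightarrow> inner_approx M \<C> A"
  unfolding inner_approx_def by (auto intro!: bexI[of _ A])

context finite_measure
begin

lemma measure_UN_geometric:
  fixes D :: "nat \<Rightarrow> 'a set"
  assumes D: "\<And>i. D i \<in> sets M" and e: "\<And>i. measure M (D i) < \<epsilon> * (1/2) ^ (i + 2)" and "0 < \<epsilon>"
  shows "measure M (\<Union>i. D i) < \<epsilon>"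
proof -
  \<comment> \<open>The exponent \<open>i + 2\<close> makes the total \<open>\<epsilon> / 2\<close>,
    which leaves the final inequality strict.\<close>
  have sums: "(\<lambda>i. \<epsilon> * (1/2) ^ (i + 2)) sums (\<epsilon> / 2)"
    using sums_mult[OF geometric_sums[of "1/2 :: real"], of "\<epsilon> / 4"] by (simp add: power_add)
  have s: "summable (\<lambda>i. measure M (D i))"
    by (rule summable_comparison_test'[OF sums_summable[OF sums], of 0]) (use e in \<open>auto intro: less_imp_le\<close>)
  have "measure M (\<Union>i. D i) \<le> (\<Sum>i. measure M (D i))"
    using D s by (intro finite_measure_subadditive_countably) auto
  also have "\<dots> \<le> (\<Sum>i. \<epsilon> * (1/2) ^ (i + 2))"
    using e by (intro suminf_le s sums_summable[OF sums] less_imp_le)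
  also have "\<dots> = \<epsilon> / 2" using sums by (rule sums_unique[symmetric])
  also have "\<dots> < \<epsilon>" using \<open>0 < \<epsilon>\<close> by simp
  finally show ?thesis .
qed

lemma measure_diff_UN_less:
  fixes a :: "nat \<Rightarrow> 'a set"
  assumes "\<And>i. a i \<in> sets M" "0 < \<epsilon>"
  obtains n where "measure M ((\<Union>i. a i) - (\<Union>i<n. a i)) < \<epsilon>"
proof -
  define D where "D n = (\<Union>i. a i) - (\<Union>i<n. a i)" for n
  have "(\<lambda>n. measure M (D n)) \<longlonglongrightarrow> measure M (\<Inter>n. D n)"
    using assms by (intro finite_Lim_measure_decseq) (auto simp: D_def decseq_def)
  moreover have "(\<Inter>n. D n) = {}" unfolding D_def by auto
  ultimately have "(\<lambda>n. measure M (D n)) \<longlonglongrightarrow> 0" by simp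
  then have "eventually (\<lambda>n. measure M (D n) < \<epsilon>) sequentially"
    using \<open>0 < \<epsilon>\<close> by (rule order_tendstoD)
  then show ?thesis using that by (auto simp: eventually_sequentially D_def)
qed

lemma inner_approx_Un:
  assumes \<C>: "\<C> \<subseteq> sets M" "\<And>C D. C \<in> \<C> \<Longrightarrow> D \<in> \<C> \<Longrightarrow> C \<union> D \<in> \<C>"
    and m: "A \<in> sets M" "B \<in> sets M" and a: "inner_approx M \<C> A" "inner_approx M \<C> B"
  shows "inner_approx M \<C> (A \<union> B)"
  unfolding inner_approx_def
proof (intro allI impI)
  fix \<epsilon> :: real assume "0 < \<epsilon>"
  then have e: "0 < \<epsilon> / 2" by simp
  obtain C where C: "C \<in> \<C>" "C \<subseteq> A" "measure M (A - C) < \<epsilon> / 2" by (rule inner_approxE[OF a(1) e])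
  obtain D where D: "D \<in> \<C>" "D \<subseteq> B" "measure M (B - D) < \<epsilon> / 2" by (rule inner_approxE[OF a(2) e])
  have "measure M ((A \<union> B) - (C \<union> D)) \<le> measure M ((A - C) \<union> (B - D))"
    using \<C> m C D by (intro finite_measure_mono) auto
  also have "\<dots> \<le> measure M (A - C) + measure M (B - D)"
    using \<C> m C D by (intro measure_Un_le) auto
  also have "\<dots> < \<epsilon>" using C D by simp
  finally show "\<exists>C\<in>\<C>. C \<subseteq> A \<union> B \<and> measure M (A \<union> B - C) < \<epsilon>"
    using C D \<C> by (intro bexI[of _ "C \<union> D"]) auto
qed

text \<open>Classes of closed or compact sets need not contain countable unions, so the union is cut
  down to finitely many sets before it is approximated.\<close>

lemma inner_approx_UN:
  fixes a :: "nat \<Rightarrow> 'a set"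
  assumes \<C>: "\<C> \<subseteq> sets M" "\<And>C D. C \<in> \<C> \<Longrightarrow> D \<in> \<C> \<Longrightarrow> C \<union> D \<in> \<C>" "{} \<in> \<C>"
    and m: "\<And>i. a i \<in> sets M" and a: "\<And>i. inner_approx M \<C> (a i)"
  shows "inner_approx M \<C> (\<Union>i. a i)"
  unfolding inner_approx_def
proof (intro allI impI)
  fix \<epsilon> :: real assume "0 < \<epsilon>"
  then have e: "0 < \<epsilon> / 2" by simp
  have fin: "inner_approx M \<C> (\<Union>i<n. a i)" for n
  proof (induction n)
    case 0
    show ?case using \<C>(3) by (simp add: inner_approx_self)
  next
    case (Suc n)
    have "inner_approx M \<C> (a n \<union> (\<Union>i<n. a i))"
      by (rule inner_approx_Un[OF \<C>(1,2) _ _ a Suc]) (use m in auto)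
    then show ?case by (simp add: lessThan_Suc)
  qed
  obtain n where n: "measure M ((\<Union>i. a i) - (\<Union>i<n. a i)) < \<epsilon> / 2"
    by (rule measure_diff_UN_less[OF m e])
  obtain C where C: "C \<in> \<C>" "C \<subseteq> (\<Union>i<n. a i)" "measure M ((\<Union>i<n. a i) - C) < \<epsilon> / 2"
    by (rule inner_approxE[OF fin e])
  have "measure M ((\<Union>i. a i) - C) \<le> measure M (((\<Union>i. a i) - (\<Union>i<n. a i)) \<union> ((\<Union>i<n. a i) - C))"
    using \<C> m C by (intro finite_measure_mono) auto
  also have "\<dots> \<le> measure M ((\<Union>i. a i) - (\<Union>i<n. a i)) + measure M ((\<Union>i<n. a i) - C)"
    using \<C> m C by (intro measure_Un_le) auto
  also have "\<dots> < \<epsilon>" using C n by simp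
  finally show "\<exists>C\<in>\<C>. C \<subseteq> (\<Union>i. a i) \<and> measure M ((\<Union>i. a i) - C) < \<epsilon>"
    using C by (intro bexI[of _ C]) auto
qed

lemma inner_approx_INT:
  fixes a :: "nat \<Rightarrow> 'a set"
  assumes \<C>: "\<C> \<subseteq> sets M" "\<And>C. range C \<subseteq> \<C> \<Longrightarrow> (\<Inter>i::nat. C i) \<in> \<C>"
    and m: "\<And>i. a i \<in> sets M" and a: "\<And>i. inner_approx M \<C> (a i)"
  shows "inner_approx M \<C> (\<Inter>i. a i)"
  unfolding inner_approx_def
proof (intro allI impI)
  fix \<epsilon> :: real assume e: "0 < \<epsilon>"
  have "\<exists>C. C \<in> \<C> \<and> C \<subseteq> a i \<and> measure M (a i - C) < \<epsilon> * (1/2) ^ (i + 2)" for i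
    by (rule inner_approxE[OF a[of i], of "\<epsilon> * (1/2) ^ (i + 2)"]) (use e in auto)
  then obtain C where C: "\<And>i. C i \<in> \<C>" "\<And>i. C i \<subseteq> a i" "\<And>i. measure M (a i - C i) < \<epsilon> * (1/2) ^ (i + 2)"
    by metis
  have Cm: "C i \<in> sets M" for i using C \<C> by auto
  have "measure M ((\<Inter>i. a i) - (\<Inter>i. C i)) \<le> measure M (\<Union>i. a i - C i)"
    using m Cm by (intro finite_measure_mono) auto
  also have "\<dots> < \<epsilon>"
    using m Cm C e by (intro measure_UN_geometric) auto
  finally show "\<exists>D\<in>\<C>. D \<subseteq> (\<Inter>i. a i) \<and> measure M ((\<Inter>i. a i) - D) < \<epsilon>"
    using C(1,2) by (intro bexI[of _ "\<Inter>i. C i"] \<C>) blast+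
qed

text \<open>Inner approximability does not pass to complements by itself, so the induction carries
  each set together with its complement; a union on one side is an intersection on the
  other.\<close>

lemma inner_approx_sigma_sets:
  assumes M: "sets M = sigma_sets (space M) \<G>"
    and \<C>: "\<C> \<subseteq> sets M" "\<And>C D. C \<in> \<C> \<Longrightarrow> D \<in> \<C> \<Longrightarrow> C \<union> D \<in> \<C>" "{} \<in> \<C>" "space M \<in> \<C>"
      "\<And>C. range C \<subseteq> \<C> \<Longrightarrow> (\<Inter>i::nat. C i) \<in> \<C>"
    and gen: "\<And>A. A \<in> \<G> \<Longrightarrow> inner_approx M \<C> A" "\<And>A. A \<in> \<G> \<Longrightarrow> inner_approx M \<C> (space M - A)"
    and A: "A \<in> sets M"
  shows "inner_approx M \<C> A"
proof -
  from A[unfolded M] have "A \<in> sets M \<and> inner_approx M \<C> A \<and> inner_approx M \<C> (space M - A)"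
  proof (induction A)
    case (Basic a)
    then show ?case using gen sigma_sets.Basic[OF Basic, of "space M"] unfolding M by blast
  next
    case Empty
    show ?case using \<C>(3,4) by (simp add: inner_approx_self)
  next
    case (Compl a)
    then have "space M - (space M - a) = a" using sets.sets_into_space by auto
    with Compl.IH show ?case by (simp only: sets.compl_sets simp_thms)
  next
    case (Union a)
    then have 1: "a i \<in> sets M" "inner_approx M \<C> (a i)" "inner_approx M \<C> (space M - a i)" for i by auto
    have "inner_approx M \<C> (\<Inter>i. space M - a i)"
      by (rule inner_approx_INT[OF \<C>(1,5)]) (use 1 in auto)
    moreover have "inner_approx M \<C> (\<Union>i. a i)"
      by (rule inner_approx_UN[OF \<C>(1,2,3) 1(1,2)])
    moreover have "space M - (\<Union>i. a i) = (\<Inter>i. space M - a i)" by auto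
    moreover have "(\<Union>i. a i) \<in> sets M" using 1(1) by (intro sets.countable_UN) blast
    ultimately show ?case by (simp only: simp_thms)
  qed
  then show ?thesis by blast
qed

end

text \<open>An open set of a metrizable space is a countable union of closed sets, and its
  complement is closed.\<close>

lemma closedin_inner_approx:
  assumes "finite_measure M" "metrizable_space T" "topspace T = space M"
    and sets: "sets M = sigma_sets (space M) {U. openin T U}" and A: "A \<in> sets M"
  shows "inner_approx M {C. closedin T C} A"
proof -
  interpret finite_measure M by fact
  have open_sets: "U \<in> sets M" if "openin T U" for U
    using that sets by (auto intro: sigma_sets.Basic)
  have closed_sets: "C \<in> sets M" if C: "closedin T C" for C
  proof -
    have "space M - (space M - C) \<in> sets M"
      using C assms(3) open_sets[of "space M - C"] by (auto simp: closedin_def)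
    also have "space M - (space M - C) = C" using closedin_subset[OF C] assms(3) by auto
    finally show ?thesis .
  qed
  show ?thesis
  proof (rule inner_approx_sigma_sets[OF sets _ _ _ _ _ _ _ A])
    fix U assume U: "U \<in> {U. openin T U}"
    then have "fsigma_in T U" using assms(2) open_imp_fsigma_in by blast
    then obtain C where C: "\<And>n::nat. closedin T (C n)" "\<Union> (range C) = U"
      unfolding fsigma_in_ascending by blast
    have "inner_approx M {C. closedin T C} (\<Union>n. C n)"
      using C closed_sets by (intro inner_approx_UN inner_approx_self) auto
    then show "inner_approx M {C. closedin T C} U" using C by simp
    show "inner_approx M {C. closedin T C} (space M - U)"
      using U assms(3) by (intro inner_approx_self) (auto simp: openin_closedin_eq)
  qed (use closed_sets assms(3) in \<open>auto intro!: closedin_Inter closedin_topspace[of T, unfolded assms(3)]\<close>)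
qed

text \<open>Ulam's argument: for each radius, finitely many balls around a dense sequence cover all
  but a small measure. Intersecting over the radii gives a totally bounded set, whose closure is
  compact by completeness.\<close>

lemma finite_measure_tight:
  assumes "finite_measure M" and T: "completely_metrizable_space T" "second_countable T"
    and top: "topspace T = space M" and sets: "sets M = sigma_sets (space M) {U. openin T U}"
    and e: "0 < \<epsilon>"
  obtains K where "compactin T K" "closedin T K" "K \<in> sets M" "measure M (space M - K) < \<epsilon>"
proof (cases "space M = {}")
  case True
  then show ?thesis using that[of "{}"] e by simp
next
  case False
  interpret finite_measure M by fact
  obtain X d where Xd: "Metric_space X d" "Metric_space.mcomplete X d" "T = Metric_space.mtopology X d"
    using T(1) by (auto simp: completely_metrizable_space_def)
  interpret Metric_space X d by fact
  have X: "X = space M" using top Xd(3) by simp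
  have open_sets: "U \<in> sets M" if "openin T U" for U
    using that sets by (auto intro: sigma_sets.Basic)
  obtain C where C: "countable C" "C \<subseteq> X" "T closure_of C = X"
    using second_countable_imp_separable_space[OF T(2)] top X by (auto simp: separable_space_def)
  have "C \<noteq> {}" using C False X by auto
  define c where "c = from_nat_into C"
  have rc: "range c = C" unfolding c_def using \<open>C \<noteq> {}\<close> C(1) by (rule range_from_nat_into)
  define r where "r n = inverse (real (Suc n))" for n
  have r0: "0 < r n" for n by (simp add: r_def)
  have cov: "(\<Union>i. mball (c i) (r n)) = space M" for n
  proof
    show "space M \<subseteq> (\<Union>i. mball (c i) (r n))"
    proof
      fix x assume x: "x \<in> space M"
      then have "x \<in> mtopology closure_of C" using C X Xd by simp
      then obtain y where "y \<in> C" "y \<in> mball x (r n)" using r0[of n] by (auto simp: metric_closure_of)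
      with rc obtain i where "c i \<in> mball x (r n)" by auto
      then have "x \<in> mball (c i) (r n)" by (auto simp: commute)
      then show "x \<in> (\<Union>i. mball (c i) (r n))" by auto
    qed
  qed (use mball_subset_mspace X in blast)
  have ball: "mball x s \<in> sets M" for x s using open_sets Xd(3) by auto
  have "\<exists>k. measure M (space M - (\<Union>i<k. mball (c i) (r n))) < \<epsilon> * (1/2) ^ (n + 2)" for n
  proof -
    have "0 < \<epsilon> * (1/2) ^ (n + 2)" using e by simp
    with ball obtain k where
      "measure M ((\<Union>i. mball (c i) (r n)) - (\<Union>i<k. mball (c i) (r n))) < \<epsilon> * (1/2) ^ (n + 2)"
      by (rule measure_diff_UN_less)
    then show ?thesis unfolding cov by (rule exI)
  qed
  then obtain k where k: "\<And>n. measure M (space M - (\<Union>i<k n. mball (c i) (r n))) < \<epsilon> * (1/2) ^ (n + 2)"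
    by metis
  define K0 where "K0 = space M \<inter> (\<Inter>n. \<Union>i<k n. mball (c i) (r n))"
  have K0X: "K0 \<subseteq> X" by (auto simp: K0_def X)
  have "mtotally_bounded K0"
    unfolding mtotally_bounded_def
  proof (intro allI impI)
    fix \<delta> :: real assume "0 < \<delta>"
    then obtain n where n: "r n < \<delta> / 2" using reals_Archimedean[of "\<delta> / 2"] by (auto simp: r_def)
    define I where "I = {i. i < k n \<and> mball (c i) (r n) \<inter> K0 \<noteq> {}}"
    \<comment> \<open>Total boundedness asks for centres inside \<open>K0\<close>. Replacing
      \<open>c i\<close> by a point of \<open>K0\<close> in its ball at most doubles the radius,
      hence \<open>\<delta> / 2\<close> above.\<close>
    define p where "p i = (SOME x. x \<in> mball (c i) (r n) \<inter> K0)" for i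
    have p: "p i \<in> mball (c i) (r n) \<inter> K0" if "i \<in> I" for i
    proof -
      have "mball (c i) (r n) \<inter> K0 \<noteq> {}" using that unfolding I_def mem_Collect_eq by (rule conjunct2)
      then show ?thesis unfolding p_def by (rule some_in_eq[THEN iffD2])
    qed
    show "\<exists>F. finite F \<and> F \<subseteq> K0 \<and> K0 \<subseteq> (\<Union>x\<in>F. mball x \<delta>)"
    proof (intro exI[of _ "p ` I"] conjI subsetI)
      show "finite (p ` I)" by (simp add: I_def)
      show "x \<in> K0" if "x \<in> p ` I" for x using that p by auto
      fix x assume x: "x \<in> K0"
      then obtain i where i: "i < k n" "x \<in> mball (c i) (r n)" by (auto simp: K0_def)
      then have iI: "i \<in> I" using x by (auto simp: I_def)
      have "d (p i) x \<le> d (p i) (c i) + d (c i) x"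
        using p[OF iI] i by (intro triangle) auto
      also have "\<dots> < \<delta>" using p[OF iI] i n by (auto simp: commute)
      finally have "x \<in> mball (p i) \<delta>" using p[OF iI] i by auto
      then show "x \<in> (\<Union>x\<in>p ` I. mball x \<delta>)" using iI by auto
    qed
  qed
  then have comp: "compactin T (T closure_of K0)"
    using mtotally_bounded_eq_compact_closure_of Xd by auto
  have cl: "closedin T (T closure_of K0)" by simp
  have "space M - (space M - T closure_of K0) \<in> sets M"
    using cl top open_sets[of "space M - T closure_of K0"] by (auto simp: closedin_def)
  also have "space M - (space M - T closure_of K0) = T closure_of K0"
    using closure_of_subset_topspace[of T K0] top by auto
  finally have m: "T closure_of K0 \<in> sets M" .
  have "measure M (space M - T closure_of K0) \<le> measure M (\<Union>n. space M - (\<Union>i<k n. mball (c i) (r n)))"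
    using closure_of_subset[of K0 T] K0X X top ball
    by (intro finite_measure_mono) (auto simp: K0_def subset_iff)
  also have "\<dots> < \<epsilon>" using k e ball by (intro measure_UN_geometric) auto
  finally show ?thesis by (rule that[OF comp cl m])
qed

text \<open>A compact class in the sense of Marczewski: countable compactness without a topology,
  the form in which compactness enters the treatment of injective maps below.\<close>

definition compact_class :: "'a set set \<Rightarrow> bool" where
  "compact_class \<K> \<longleftrightarrow> (\<forall>K :: nat \<Rightarrow> 'a set. range K \<subseteq> \<K> \<longrightarrow> (\<forall>N. (\<Inter>i\<le>N. K i) \<noteq> {}) \<longrightarrow> (\<Inter>i. K i) \<noteq> {})"

lemma compact_class_subset: "compact_class \<K> \<Longrightarrow> \<K>' \<subseteq> \<K> \<Longrightarrow> compact_class \<K>'"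
  unfolding compact_class_def by (meson subset_trans)

text \<open>Compactness of \<open>K 0\<close>, applied to the whole sequence as closed sets with the
  finite intersection property.\<close>

lemma compact_class_compactin: "compact_class {K. compactin T K \<and> closedin T K}"
  unfolding compact_class_def
proof (intro allI impI)
  fix K :: "nat \<Rightarrow> 'a set"
  assume K: "range K \<subseteq> {K. compactin T K \<and> closedin T K}" and ne: "\<forall>N. (\<Inter>i\<le>N. K i) \<noteq> {}"
  have fip: "\<And>\<U>. (\<forall>C\<in>\<U>. closedin T C) \<and> (\<forall>\<F>. finite \<F> \<and> \<F> \<subseteq> \<U> \<longrightarrow> K 0 \<inter> \<Inter>\<F> \<noteq> {}) \<Longrightarrow> K 0 \<inter> \<Inter>\<U> \<noteq> {}"
    using K compactin_fip[of T "K 0"] by auto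
  have "K 0 \<inter> \<Inter> (range K) \<noteq> {}"
  proof (rule fip, intro conjI ballI allI impI)
    show "closedin T C" if "C \<in> range K" for C using that K by auto
    fix \<F> assume "finite \<F> \<and> \<F> \<subseteq> range K"
    then obtain I where I: "finite I" "\<F> = K ` I" by (meson finite_subset_image)
    then obtain N where "\<forall>i\<in>I. i \<le> N" by (meson finite_nat_set_iff_bounded_le)
    with I have "(\<Inter>i\<le>N. K i) \<subseteq> K 0 \<inter> \<Inter>\<F>" by auto
    moreover obtain x where "x \<in> (\<Inter>i\<le>N. K i)" using ne[rule_format, of N] by (meson ex_in_conv)
    ultimately have "x \<in> K 0 \<inter> \<Inter>\<F>" by (rule subsetD)
    then show "K 0 \<inter> \<Inter>\<F> \<noteq> {}" by (metis empty_iff)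
  qed
  then show "(\<Inter>i. K i) \<noteq> {}" by blast
qed

section \<open>Inner regularity passes to products\<close>

lemma measure_PiM_component:
  assumes M: "prob_space M" and i: "i \<in> I" and A: "A \<in> sets M"
  shows "measure (\<Pi>\<^sub>M i\<in>I. M) {f \<in> \<Pi>\<^sub>E i\<in>I. space M. f i \<in> A} = measure M A"
proof -
  have "measure M A = measure (distr (\<Pi>\<^sub>M i\<in>I. M) M (\<lambda>f. f i)) A"
    using distr_PiM_component[of I "\<lambda>_. M" i] M i by simp
  also have "\<dots> = measure (\<Pi>\<^sub>M i\<in>I. M) ((\<lambda>f. f i) -` A \<inter> space (\<Pi>\<^sub>M i\<in>I. M))"
    using i A by (intro measure_distr) auto
  also have "(\<lambda>f. f i) -` A \<inter> space (\<Pi>\<^sub>M i\<in>I. M) = {f \<in> \<Pi>\<^sub>E i\<in>I. space M. f i \<in> A}"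
    by (auto simp: space_PiM)
  finally show ?thesis by simp
qed

lemma sets_PiM_component:
  assumes "i \<in> I" "A \<in> sets M"
  shows "{f \<in> \<Pi>\<^sub>E i\<in>I. space M. f i \<in> A} \<in> sets (\<Pi>\<^sub>M i\<in>I. M)"
  unfolding sets_PiM_single using assms by (intro sigma_sets.Basic) blast

text \<open>One-coordinate events suffice, and there a closed subset of the factor pulls back to a
  closed set. Measurability is imposed separately because a closed set of an uncountable product may
  lack it.\<close>

lemma PiM_closed_inner_approx:
  fixes M :: "'x measure" and I :: "'i set"
  assumes M: "prob_space M" and T: "metrizable_space T" and top: "topspace T = space M"
    and sets: "sets M = sigma_sets (space M) {U. openin T U}" and S: "S \<in> sets (\<Pi>\<^sub>M i\<in>I. M)"
  shows "inner_approx (\<Pi>\<^sub>M i\<in>I. M)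
    {C \<in> sets (\<Pi>\<^sub>M i\<in>I. M). closedin (product_topology (\<lambda>_. T) I) C} S"
proof -
  interpret M: prob_space M by fact
  interpret P: prob_space "\<Pi>\<^sub>M i\<in>I. M" using M by (intro prob_space_PiM)
  let ?C = "{C \<in> sets (\<Pi>\<^sub>M i\<in>I. M). closedin (product_topology (\<lambda>_. T) I) C}"
  have gen: "inner_approx (\<Pi>\<^sub>M i\<in>I. M) ?C {f \<in> \<Pi>\<^sub>E i\<in>I. space M. f i \<in> A}"
    if i: "i \<in> I" and A: "A \<in> sets M" for i A
    unfolding inner_approx_def
  proof (intro allI impI)
    fix \<epsilon> :: real assume e: "0 < \<epsilon>"
    have "inner_approx M {C. closedin T C} A"
      by (rule closedin_inner_approx[OF _ T top sets A]) unfold_locales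
    then obtain C where C: "closedin T C" "C \<subseteq> A" "measure M (A - C) < \<epsilon>"
      using e by (auto elim: inner_approxE)
    have "space M - C \<in> sets M"
      using C sets top by (auto simp: closedin_def intro: sigma_sets.Basic)
    then have Cm: "C \<in> sets M"
      using sets.compl_sets[of "space M - C" M] closedin_subset[OF C(1)] top by (simp add: double_diff)
    let ?D = "{f \<in> \<Pi>\<^sub>E i\<in>I. space M. f i \<in> C}"
    have "closedin (product_topology (\<lambda>_. T) I) {f \<in> topspace (product_topology (\<lambda>_. T) I). f i \<in> C}"
      using i C by (intro closedin_continuous_map_preimage[of _ T] continuous_map_product_projection)
    then have "?D \<in> ?C" using sets_PiM_component[OF i Cm] top by simp
    moreover have "?D \<subseteq> {f \<in> \<Pi>\<^sub>E i\<in>I. space M. f i \<in> A}" using C by auto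
    moreover have "{f \<in> \<Pi>\<^sub>E i\<in>I. space M. f i \<in> A} - ?D = {f \<in> \<Pi>\<^sub>E i\<in>I. space M. f i \<in> A - C}" by auto
    then have "P.prob ({f \<in> \<Pi>\<^sub>E i\<in>I. space M. f i \<in> A} - ?D) < \<epsilon>"
      using measure_PiM_component[OF M i, of "A - C"] A Cm C(3) by simp
    ultimately show "\<exists>C\<in>?C. C \<subseteq> {f \<in> \<Pi>\<^sub>E i\<in>I. space M. f i \<in> A} \<and>
        P.prob ({f \<in> \<Pi>\<^sub>E i\<in>I. space M. f i \<in> A} - C) < \<epsilon>"
      by blast
  qed
  show ?thesis
  proof (rule P.inner_approx_sigma_sets[OF sets_PiM_single[of I "\<lambda>_. M", folded space_PiM] _ _ _ _ _ _ _ S])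
    fix A assume "A \<in> {{f \<in> space (\<Pi>\<^sub>M i\<in>I. M). f i \<in> A} |i A. i \<in> I \<and> A \<in> sets M}"
    then obtain i B where iB: "i \<in> I" "B \<in> sets M" "A = {f \<in> \<Pi>\<^sub>E i\<in>I. space M. f i \<in> B}"
      by (auto simp: space_PiM)
    show "inner_approx (\<Pi>\<^sub>M i\<in>I. M) ?C A" unfolding iB(3) by (rule gen[OF iB(1,2)])
    have "space (\<Pi>\<^sub>M i\<in>I. M) - A = {f \<in> \<Pi>\<^sub>E i\<in>I. space M. f i \<in> space M - B}"
      using iB by (auto simp: space_PiM)
    then show "inner_approx (\<Pi>\<^sub>M i\<in>I. M) ?C (space (\<Pi>\<^sub>M i\<in>I. M) - A)"
      using gen[OF iB(1), of "space M - B"] iB(2) by simp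
  next
    have "topspace (product_topology (\<lambda>_. T) I) = space (\<Pi>\<^sub>M i\<in>I. M)"
      using top by (simp add: space_PiM)
    then show "space (\<Pi>\<^sub>M i\<in>I. M) \<in> ?C"
      using closedin_topspace[of "product_topology (\<lambda>_. T) I"] by simp
  next
    fix C :: "nat \<Rightarrow> ('i \<Rightarrow> 'x) set" assume "range C \<subseteq> ?C"
    then show "(\<Inter>i. C i) \<in> ?C" by (auto intro!: closedin_Inter sets.countable_INT')
  qed auto
qed

text \<open>A closed approximant is intersected with a product of compact sets, which is compact by
  Tychonoff. Countability of \<open>I\<close> lets the tightness errors of the factors be
  summable.\<close>

lemma PiM_compact_inner_approx:
  assumes M: "standard_prob_space M" and I: "countable I"
  obtains \<K> where "compact_class \<K>" "\<K> \<subseteq> sets (\<Pi>\<^sub>M i\<in>I. M)"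
    "\<And>S. S \<in> sets (\<Pi>\<^sub>M i\<in>I. M) \<Longrightarrow> inner_approx (\<Pi>\<^sub>M i\<in>I. M) \<K> S"
proof -
  from M obtain T where T: "completely_metrizable_space T" "second_countable T"
    and top: "topspace T = space M" and sets: "sets M = sigma_sets (space M) {U. openin T U}"
    by (auto simp: standard_prob_space_def standard_borel_def)
  interpret M: prob_space M using M by (simp add: standard_prob_space_def)
  interpret P: prob_space "\<Pi>\<^sub>M i\<in>I. M" by (intro prob_space_PiM M.prob_space_axioms)
  let ?T = "product_topology (\<lambda>_. T) I"
  let ?P = "\<Pi>\<^sub>M i\<in>I. M"
  have metr: "metrizable_space T" using T(1) by (rule completely_metrizable_imp_metrizable_space)
  then have haus: "Hausdorff_space ?T"
    by (simp add: Hausdorff_space_product_topology metrizable_imp_Hausdorff_space)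
  define \<K> where "\<K> = {K. compactin ?T K \<and> closedin ?T K} \<inter> sets ?P"
  show ?thesis
  proof (rule that[of \<K>])
    show "compact_class \<K>"
      unfolding \<K>_def by (rule compact_class_subset[OF compact_class_compactin[of ?T]]) simp
    show "\<K> \<subseteq> sets ?P" by (simp add: \<K>_def)
    fix S assume S: "S \<in> sets ?P"
    show "inner_approx ?P \<K> S"
      unfolding inner_approx_def
    proof (intro allI impI)
      fix \<epsilon> :: real assume "0 < \<epsilon>"
      then have e: "0 < \<epsilon> / 2" by simp
      have "\<exists>K. compactin T K \<and> closedin T K \<and> K \<in> sets M \<and> measure M (space M - K) < \<epsilon> / 2 * (1/2) ^ (n + 2)" for n :: nat
        by (rule finite_measure_tight[OF M.finite_measure_axioms T top sets, of "\<epsilon> / 2 * (1/2) ^ (n + 2)"]) (use e in auto)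
      then obtain K where K: "\<And>n. compactin T (K n)" "\<And>n. closedin T (K n)" "\<And>n. K n \<in> sets M"
        "\<And>n. measure M (space M - K n) < \<epsilon> / 2 * (1/2) ^ (n + 2)" by metis
      define L where "L = (\<Pi>\<^sub>E i\<in>I. K (to_nat_on I i))"
      have Lc: "compactin ?T L" using K by (auto simp: L_def compactin_PiE)
      have Lcl: "closedin ?T L" using haus Lc by (rule compactin_imp_closedin)
      have Lm: "L \<in> sets ?P"
        unfolding L_def using K by (intro sets_PiM_I_countable I) auto
      \<comment> \<open>The event that the coordinate numbered \<open>n\<close> leaves
        \<open>K n\<close>. Numbers belonging to no coordinate, as happens for finite
        \<open>I\<close>, get the empty event.\<close>
      define D where "D n = (if n \<in> to_nat_on I ` I
        then {f \<in> \<Pi>\<^sub>E i\<in>I. space M. f (from_nat_into I n) \<in> space M - K n} else {})" for n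
      have fI: "from_nat_into I n \<in> I" if "n \<in> to_nat_on I ` I" for n
        using that I by auto
      have "space ?P - L \<subseteq> (\<Union>n. D n)"
      proof
        fix f assume f: "f \<in> space ?P - L"
        then obtain i where i: "i \<in> I" "f i \<notin> K (to_nat_on I i)"
          by (auto simp: L_def space_PiM PiE_iff)
        with f have "f \<in> D (to_nat_on I i)" using I by (auto simp: D_def space_PiM PiE_iff)
        then show "f \<in> (\<Union>n. D n)" by blast
      qed
      moreover have Dm: "D n \<in> sets ?P" for n
        using K sets_PiM_component[OF fI, of n "space M - K n" M] by (auto simp: D_def)
      ultimately have "P.prob (space ?P - L) \<le> P.prob (\<Union>n. D n)"
        by (intro P.finite_measure_mono) auto
      also have "\<dots> < \<epsilon> / 2"
      proof (rule P.measure_UN_geometric[OF Dm _ e])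
        fix n
        show "P.prob (D n) < \<epsilon> / 2 * (1/2) ^ (n + 2)"
        proof (cases "n \<in> to_nat_on I ` I")
          case True
          have "P.prob (D n) = measure M (space M - K n)"
            using measure_PiM_component[OF M.prob_space_axioms fI[OF True], of "space M - K n"] True K
            by (simp add: D_def)
          with K(4) show ?thesis by simp
        next
          case False
          then show ?thesis using e by (simp add: D_def)
        qed
      qed
      finally have L: "P.prob (space ?P - L) < \<epsilon> / 2" .
      obtain C where C: "C \<in> sets ?P" "closedin ?T C" "C \<subseteq> S" "P.prob (S - C) < \<epsilon> / 2"
        by (rule inner_approxE[OF PiM_closed_inner_approx[OF M.prob_space_axioms metr top sets S] e]) auto
      have "C \<inter> L \<in> \<K>"
        using C Lc Lcl Lm closed_Int_compactin[OF C(2) Lc] by (auto simp: \<K>_def closedin_Int)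
      moreover have "P.prob (S - C \<inter> L) \<le> P.prob ((S - C) \<union> (space ?P - L))"
        using S C Lm sets.sets_into_space[OF S] by (intro P.finite_measure_mono) auto
      then have "P.prob (S - C \<inter> L) < \<epsilon>"
        using measure_Un_le[of "S - C" ?P "space ?P - L"] S C Lm L by simp
      ultimately show "\<exists>C\<in>\<K>. C \<subseteq> S \<and> P.prob (S - C) < \<epsilon>" using C by blast
    qed
  qed
qed

text \<open>Distinct points differ in some coordinate, where the Hausdorff property and a countable
  base give a base set containing just one of the two values. Countably many coordinates keep the
  family countable.\<close>

lemma standard_borel_separating:
  assumes "standard_borel M" and I: "countable I"
  obtains J :: "nat \<Rightarrow> ('i \<Rightarrow> 'a) set" where "\<And>n. J n \<in> sets (\<Pi>\<^sub>M i\<in>I. M)"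
    "\<And>x y. x \<in> space (\<Pi>\<^sub>M i\<in>I. M) \<Longrightarrow> y \<in> space (\<Pi>\<^sub>M i\<in>I. M) \<Longrightarrow> (\<And>n. x \<in> J n \<longleftrightarrow> y \<in> J n) \<Longrightarrow> x = y"
proof -
  from assms obtain T where T: "completely_metrizable_space T" "second_countable T"
    and top: "topspace T = space M" and sets: "sets M = sigma_sets (space M) {U. openin T U}"
    by (auto simp: standard_borel_def)
  have haus: "Hausdorff_space T"
    using T(1) by (simp add: completely_metrizable_imp_metrizable_space metrizable_imp_Hausdorff_space)
  obtain \<B> where \<B>: "countable \<B>" "\<forall>V\<in>\<B>. openin T V"
    "\<forall>U x. openin T U \<and> x \<in> U \<longrightarrow> (\<exists>V\<in>\<B>. x \<in> V \<and> V \<subseteq> U)"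
    using T(2)[unfolded second_countable_def] by (elim exE conjE) (rule that)
  \<comment> \<open>The empty set keeps the family nonempty, as its enumeration requires, even for
    empty \<open>I\<close>.\<close>
  define \<J> where "\<J> = insert {} ((\<lambda>(i, V). {f \<in> \<Pi>\<^sub>E i\<in>I. space M. f i \<in> V}) ` (I \<times> \<B>))"
  have J: "countable \<J>" "\<J> \<noteq> {}" using \<B>(1) I by (auto simp: \<J>_def)
  have Bm: "V \<in> sets M" if "V \<in> \<B>" for V using sets \<B>(2)[rule_format, OF that] by (auto intro: sigma_sets.Basic)
  have rJ: "range (from_nat_into \<J>) = \<J>" using J by (intro range_from_nat_into)
  show ?thesis
  proof (rule that[of "from_nat_into \<J>"])
    fix n
    have "from_nat_into \<J> n \<in> \<J>" using rJ by blast
    moreover have "\<J> \<subseteq> sets (\<Pi>\<^sub>M i\<in>I. M)"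
      unfolding \<J>_def using Bm by (auto intro!: sets_PiM_component)
    ultimately show "from_nat_into \<J> n \<in> sets (\<Pi>\<^sub>M i\<in>I. M)" by blast
  next
    fix x y assume x: "x \<in> space (\<Pi>\<^sub>M i\<in>I. M)" and y: "y \<in> space (\<Pi>\<^sub>M i\<in>I. M)"
      and eq: "\<And>n. x \<in> from_nat_into \<J> n \<longleftrightarrow> y \<in> from_nat_into \<J> n"
    have eqJ: "x \<in> A \<longleftrightarrow> y \<in> A" if "A \<in> \<J>" for A
      using that eq rJ by (metis rangeE)
    show "x = y"
    proof (rule PiE_ext[OF x[unfolded space_PiM] y[unfolded space_PiM]], rule ccontr)
      fix i assume i: "i \<in> I" "x i \<noteq> y i"
      have "x i \<in> topspace T" "y i \<in> topspace T" using x y i top by (auto simp: space_PiM)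
      with haus i obtain U V where UV: "openin T U" "openin T V" "x i \<in> U" "y i \<in> V" "disjnt U V"
        unfolding Hausdorff_space_def by blast
      then obtain W where W: "W \<in> \<B>" "x i \<in> W" "W \<subseteq> U" using \<B>(3) by blast
      then have "y i \<notin> W" using UV by (auto simp: disjnt_iff)
      moreover have "{f \<in> \<Pi>\<^sub>E i\<in>I. space M. f i \<in> W} \<in> \<J>" using W i by (auto simp: \<J>_def)
      from eqJ[OF this] have "y i \<in> W" using x y W by (simp add: space_PiM)
      ultimately show False by simp
    qed
  qed
qed

text \<open>This replaces the Lusin-Souslin theorem.  For the pieces \<open>K n\<close> and \<open>K' n\<close> of \<open>S\<close>
  on which \<open>f\<close> takes values inside resp. outside \<open>J n\<close>, the set \<open>B\<close> is the image under \<open>f\<close> of the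
  intersection of all \<open>K n \<union> K' n\<close>; the compactness property makes it a countable intersection of
  sets defined by finitely many \<open>J n\<close>.\<close>

lemma injective_image_approx:
  assumes "finite_measure M" and \<K>: "compact_class \<K>" "\<K> \<subseteq> sets M"
    "\<And>S. S \<in> sets M \<Longrightarrow> inner_approx M \<K> S"
    and f: "f \<in> restrict_space M A \<rightarrow>\<^sub>M N" and A: "A \<in> sets M" and inj: "inj_on f A"
    and J: "\<And>n::nat. J n \<in> sets N"
    and sep: "\<And>x y. x \<in> space N \<Longrightarrow> y \<in> space N \<Longrightarrow> (\<And>n. x \<in> J n \<longleftrightarrow> y \<in> J n) \<Longrightarrow> x = y"
    and S: "S \<in> sets M" "S \<subseteq> A" and e: "0 < \<epsilon>"
  obtains B where "B \<in> sets N" "{x\<in>A. f x \<in> B} \<subseteq> S" "measure M (S - {x\<in>A. f x \<in> B}) < \<epsilon>"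
proof -
  interpret finite_measure M by fact
  have spA: "space (restrict_space M A) = A" using A sets.sets_into_space by (auto simp: space_restrict_space)
  have fsp: "f x \<in> space N" if "x \<in> A" for x using measurable_space[OF f] that spA by auto
  have pre: "{x\<in>A. f x \<in> B} \<in> sets M" if "B \<in> sets N" for B
  proof -
    have "f -` B \<inter> A \<in> sets (restrict_space M A)" using measurable_sets[OF f that] spA by simp
    then have "f -` B \<inter> A \<in> sets M" using A by (simp add: sets_restrict_space_iff)
    then show ?thesis by (simp add: vimage_def Int_def conj_commute)
  qed
  \<comment> \<open>Two families of errors, one for \<open>K\<close> and one for \<open>K'\<close>,
    each with total below \<open>\<epsilon> / 2\<close>.\<close>
  let ?e = "\<lambda>n::nat. \<epsilon> / 2 * (1/2) ^ (n + 2)"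
  have e': "0 < ?e n" for n using e by simp
  define P where "P n = S \<inter> {x\<in>A. f x \<in> J n}" for n
  have Pm: "P n \<in> sets M" "S - P n \<in> sets M" for n using pre[OF J] S by (auto simp: P_def)
  have "\<exists>K. K \<in> \<K> \<and> K \<subseteq> P n \<and> measure M (P n - K) < ?e n" for n
    by (rule inner_approxE[OF \<K>(3)[OF Pm(1)] e']) blast
  then obtain K where K: "\<And>n. K n \<in> \<K>" "\<And>n. K n \<subseteq> P n" "\<And>n. measure M (P n - K n) < ?e n" by metis
  have "\<exists>K. K \<in> \<K> \<and> K \<subseteq> S - P n \<and> measure M (S - P n - K) < ?e n" for n
    by (rule inner_approxE[OF \<K>(3)[OF Pm(2)] e']) blast
  then obtain K' where K': "\<And>n. K' n \<in> \<K>" "\<And>n. K' n \<subseteq> S - P n" "\<And>n. measure M (S - P n - K' n) < ?e n" by metis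
  have Km: "K n \<in> sets M" "K' n \<in> sets M" for n using K K' \<K>(2) by auto
  define L where "L y n = (if y \<in> J n then K n else K' n)" for y n
  \<comment> \<open>Each finite intersection depends on finitely many memberships
    \<open>y \<in> J n\<close>, so \<open>B\<close> is measurable without any statement about images
    under \<open>f\<close>.\<close>
  define B where "B = {y\<in>space N. \<forall>m. (\<Inter>n\<le>m. L y n) \<noteq> {}}"
  show ?thesis
  proof (rule that[of B])
    have "{y\<in>space N. (\<Inter>n\<le>m. L y n) \<noteq> {}} \<in> sets N" for m
    proof -
      have "simple_function N (\<lambda>y. \<lambda>n\<in>{..m}. y \<in> J n)"
        using J by (intro simple_function_restrict simple_function_bool) auto
      from simple_function_Collect[OF this, of "\<lambda>c. (\<Inter>n\<le>m. if c n then K n else K' n) \<noteq> {}"]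
      show ?thesis by (simp add: L_def)
    qed
    then have "(\<Inter>m. {y\<in>space N. (\<Inter>n\<le>m. L y n) \<noteq> {}}) \<in> sets N" by (intro sets.countable_INT') auto
    also have "(\<Inter>m. {y\<in>space N. (\<Inter>n\<le>m. L y n) \<noteq> {}}) = B" by (auto simp: B_def)
    finally show Bm: "B \<in> sets N" .
    show "{x\<in>A. f x \<in> B} \<subseteq> S"
    proof
      fix x assume "x \<in> {x\<in>A. f x \<in> B}"
      then have x: "x \<in> A" "\<And>m. (\<Inter>n\<le>m. L (f x) n) \<noteq> {}" by (auto simp: B_def)
      \<comment> \<open>The compact class supplies a common point \<open>z\<close>. By construction
        \<open>f z\<close> has the same pattern of memberships as \<open>f x\<close>, so the two
        agree, and injectivity gives \<open>z = x\<close>.\<close>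
      have "range (L (f x)) \<subseteq> \<K>" using K K' by (auto simp: L_def)
      with \<K>(1) x(2) have "(\<Inter>n. L (f x) n) \<noteq> {}" unfolding compact_class_def by blast
      then obtain z where z: "\<And>n. z \<in> L (f x) n" by blast
      have zS: "z \<in> S" using z[of 0] K(2)[of 0] K'(2)[of 0] by (auto simp: L_def P_def split: if_splits)
      have "f z \<in> J n \<longleftrightarrow> f x \<in> J n" for n
        using z[of n] K(2)[of n] K'(2)[of n] zS S by (auto simp: L_def P_def split: if_splits)
      then have "f z = f x" using zS S x by (intro sep fsp) auto
      then have "z = x" using inj zS S x by (auto dest: inj_onD)
      then show "x \<in> S" using zS by simp
    qed
    have "S - {x\<in>A. f x \<in> B} \<subseteq> (\<Union>n. (P n - K n)) \<union> (\<Union>n. S - P n - K' n)"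
    proof (rule subsetI, rule ccontr)
      fix x assume x: "x \<in> S - {x\<in>A. f x \<in> B}"
        and n: "x \<notin> (\<Union>n. (P n - K n)) \<union> (\<Union>n. S - P n - K' n)"
      have xA: "x \<in> A" using x S by auto
      have "x \<in> L (f x) n" for n
      proof (cases "f x \<in> J n")
        case True
        then have "x \<in> P n" using x xA by (simp add: P_def)
        with n True show ?thesis by (auto simp: L_def)
      next
        case False
        then have "x \<notin> P n" by (simp add: P_def)
        with n x False show ?thesis by (auto simp: L_def)
      qed
      then have "f x \<in> B" using fsp[OF xA] by (auto simp: B_def)
      with x xA show False by auto
    qed
    then have "measure M (S - {x\<in>A. f x \<in> B}) \<le> measure M ((\<Union>n. (P n - K n)) \<union> (\<Union>n. S - P n - K' n))"
      using Pm Km by (intro finite_measure_mono sets.Un sets.countable_UN) auto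
    also have "\<dots> \<le> measure M (\<Union>n. (P n - K n)) + measure M (\<Union>n. S - P n - K' n)"
      using Pm Km by (intro measure_Un_le sets.countable_UN) auto
    also have "measure M (\<Union>n. (P n - K n)) < \<epsilon> / 2"
      using Pm Km K e by (intro measure_UN_geometric) auto
    also have "measure M (\<Union>n. (S - P n - K' n)) < \<epsilon> / 2"
      using Pm Km K' e by (intro measure_UN_geometric) auto
    finally show "measure M (S - {x\<in>A. f x \<in> B}) < \<epsilon>" by simp
  qed
qed

subsection \<open>Comparison of base entropies\<close>

lemma (in prob_space) shannon_le_base_entropy:
  assumes X: "simple_function M X"
  shows "ereal (shannon M X) \<le> base_entropy M"
proof -
  let ?f = "\<lambda>c. X -` {c} \<inter> space M"
  define P where "P = ?f ` X ` space M"
  have "finite_measurable_partition M P"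
    unfolding finite_measurable_partition_def
  proof (intro conjI)
    show "finite P" unfolding P_def using simple_functionD(1)[OF X] by simp
    show "P \<subseteq> sets M" unfolding P_def using simple_functionD(2)[OF X] by blast
    show "partition_on (space M) P" by (rule partition_onI) (auto simp: P_def disjnt_def)
  qed
  moreover have "inj_on ?f (X ` space M)" by (auto simp: inj_on_def)
  then have "partition_entropy M P = shannon M X"
    by (simp add: partition_entropy_def P_def shannon_def sum.reindex)
  ultimately show ?thesis unfolding base_entropy_def by (intro SUP_upper2[of P]) auto
qed

text \<open>Cells of a finite partition are nonempty and disjoint, so numbering them makes them the
  fibres of a label; natural-number labels thus exhaust the supremum.\<close>

lemma base_entropy_leI:
  assumes le: "\<And>X :: 'a \<Rightarrow> nat. simple_function M X \<Longrightarrow> ereal (shannon M X) \<le> b"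
  shows "base_entropy M \<le> b"
  unfolding base_entropy_def
proof (rule SUP_least)
  fix P assume "P \<in> {P. finite_measurable_partition M P}"
  then have P: "finite P" "P \<subseteq> sets M" "partition_on (space M) P"
    by (auto simp: finite_measurable_partition_def)
  define q where "q x = (THE Q. Q \<in> P \<and> x \<in> Q)" for x
  have q: "q x = Q" if "Q \<in> P" "x \<in> Q" for x Q
    unfolding q_def using that partition_onD2[OF P(3)]
    by (intro the_equality) (auto simp: disjoint_def)
  define X where "X x = to_nat_on P (q x)" for x
  have inj: "inj_on (to_nat_on P) P" using P(1) by (intro inj_on_to_nat_on countable_finite)
  have im: "X ` space M = to_nat_on P ` P"
  proof safe
    fix x assume "x \<in> space M"
    then obtain Q where "Q \<in> P" "x \<in> Q" using partition_onD1[OF P(3)] by auto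
    then show "X x \<in> to_nat_on P ` P" by (simp add: X_def q)
  next
    fix Q assume Q: "Q \<in> P"
    then obtain x where "x \<in> Q" using partition_onD3[OF P(3)] by (metis ex_in_conv)
    moreover have "x \<in> space M" using Q \<open>x \<in> Q\<close> partition_onD1[OF P(3)] by auto
    ultimately show "to_nat_on P Q \<in> X ` space M" using Q by (intro image_eqI[of _ _ x]) (simp_all add: X_def q)
  qed
  have pre: "X -` {to_nat_on P Q} \<inter> space M = Q" if Q: "Q \<in> P" for Q
  proof (intro equalityI subsetI)
    show "x \<in> X -` {to_nat_on P Q} \<inter> space M" if "x \<in> Q" for x
      using that Q partition_onD1[OF P(3)] by (auto simp: X_def q)
    fix x assume x: "x \<in> X -` {to_nat_on P Q} \<inter> space M"
    then obtain Q' where "Q' \<in> P" "x \<in> Q'" using partition_onD1[OF P(3)] by auto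
    then show "x \<in> Q" using x Q inj by (auto simp: X_def q dest: inj_onD)
  qed
  have "simple_function M X"
    unfolding simple_function_def im using P pre by auto
  moreover have "shannon M X = partition_entropy M P"
    unfolding shannon_def partition_entropy_def im using inj by (simp add: sum.reindex pre)
  ultimately show "ereal (partition_entropy M P) \<le> b" using le by metis
qed

text \<open>The processes \<open>u\<close> and \<open>v\<close> carry the same information.  Discretise \<open>v\<close> by \<open>\<rho>\<close> so that it
  still determines \<open>\<psi> (u \<one>)\<close> up to a small error, and express \<open>\<rho> (v \<one>)\<close> by finitely many
  coordinates of \<open>u\<close> up to a much smaller error; the bound on i.i.d. processes over the sofic
  approximation then compares the entropy of \<open>\<psi>\<close> with that of \<open>\<rho>\<close>.\<close>

lemma shannon_le_base_entropy_of_joining: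
  fixes G (structure) and M :: "'x measure" and N :: "'y measure" and \<Omega> :: "'o measure" and \<psi> :: "'y \<Rightarrow> nat"
  assumes G: "countable_sofic_group G" and M: "prob_space M" and N: "prob_space N" and \<Omega>: "prob_space \<Omega>"
    and u: "u \<in> \<Omega> \<rightarrow>\<^sub>M (\<Pi>\<^sub>M h\<in>carrier G. N)" "distr \<Omega> (\<Pi>\<^sub>M h\<in>carrier G. N) u = (\<Pi>\<^sub>M h\<in>carrier G. N)"
    and v: "v \<in> \<Omega> \<rightarrow>\<^sub>M (\<Pi>\<^sub>M h\<in>carrier G. M)" "distr \<Omega> (\<Pi>\<^sub>M h\<in>carrier G. M) v = (\<Pi>\<^sub>M h\<in>carrier G. M)"
    and stat: "\<And>g. g \<in> carrier G \<Longrightarrow> \<exists>T\<in>\<Omega> \<rightarrow>\<^sub>M \<Omega>. distr \<Omega> \<Omega> T = \<Omega> \<and> (\<forall>\<omega>\<in>space \<Omega>. \<forall>h\<in>carrier G.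
      u (T \<omega>) h = u \<omega> (g \<otimes> h) \<and> v (T \<omega>) h = v \<omega> (g \<otimes> h))"
    and uv: "\<And>S. S \<in> sets (\<Pi>\<^sub>M h\<in>carrier G. N) \<Longrightarrow> cyl_approx \<Omega> (carrier G) M v (\<lambda>\<omega>. u \<omega> \<in> S)"
    and vu: "\<And>S. S \<in> sets (\<Pi>\<^sub>M h\<in>carrier G. M) \<Longrightarrow> cyl_approx \<Omega> (carrier G) N u (\<lambda>\<omega>. v \<omega> \<in> S)"
    and \<psi>: "simple_function N \<psi>"
  shows "ereal (shannon N \<psi>) \<le> base_entropy M"
proof -
  interpret group G using G by (simp add: countable_sofic_group_def)
  interpret M: prob_space M by fact
  interpret N: prob_space N by fact
  interpret prob_space \<Omega> by fact
  note uc = measurable_compose[OF u(1) measurable_component_singleton]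
  note vc = measurable_compose[OF v(1) measurable_component_singleton]
  have usp: "u \<omega> h \<in> space N" if "\<omega> \<in> space \<Omega>" "h \<in> carrier G" for \<omega> h
    using measurable_space[OF uc] that by auto
  have vsp: "v \<omega> h \<in> space M" if "\<omega> \<in> space \<Omega>" "h \<in> carrier G" for \<omega> h
    using measurable_space[OF vc] that by auto
  \<comment> \<open>Stated for arbitrary base spaces because it is used in both directions between
    \<open>u\<close> and \<open>v\<close>.\<close>
  have coord: "cyl_approx \<Omega> (carrier G) K' w' (\<lambda>\<omega>. \<phi> (w \<omega> \<one>))"
    if w: "w \<in> \<Omega> \<rightarrow>\<^sub>M (\<Pi>\<^sub>M h\<in>carrier G. K)" and w': "w' \<in> \<Omega> \<rightarrow>\<^sub>M (\<Pi>\<^sub>M h\<in>carrier G. K')"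
      and \<phi>: "simple_function K \<phi>"
      and ww: "\<And>S. S \<in> sets (\<Pi>\<^sub>M h\<in>carrier G. K) \<Longrightarrow> cyl_approx \<Omega> (carrier G) K' w' (\<lambda>\<omega>. w \<omega> \<in> S)"
    for K :: "'k measure" and K' :: "'l measure" and w w' and \<phi> :: "'k \<Rightarrow> nat"
  proof (rule cyl_approx_nat[OF w'])
    note wc = measurable_compose[OF w measurable_component_singleton[OF one_closed]]
    show "simple_function \<Omega> (\<lambda>\<omega>. \<phi> (w \<omega> \<one>))" by (rule simple_function_comp[OF wc \<phi>])
    fix n
    let ?S = "{f \<in> \<Pi>\<^sub>E i\<in>carrier G. space K. f \<one> \<in> {x\<in>space K. n \<le> \<phi> x}}"
    have "?S \<in> sets (\<Pi>\<^sub>M h\<in>carrier G. K)"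
      by (intro sets_PiM_component one_closed simple_function_Collect[OF \<phi>])
    then have "cyl_approx \<Omega> (carrier G) K' w' (\<lambda>\<omega>. w \<omega> \<in> ?S)" by (rule ww)
    then show "cyl_approx \<Omega> (carrier G) K' w' (\<lambda>\<omega>. n \<le> \<phi> (w \<omega> \<one>))"
      by (subst cyl_approx_cong[where b'="\<lambda>\<omega>. w \<omega> \<in> ?S"])
        (use measurable_space[OF w] measurable_space[OF wc] in \<open>auto simp: space_PiM\<close>)
  qed
  show ?thesis
  proof (rule ereal_le_epsilon2)
    fix \<delta>' :: real assume "0 < \<delta>'"
    \<comment> \<open>Two error labels will cost \<open>\<delta>\<close> each: \<open>Z\<close> for
      the decoding of \<open>\<psi>\<close>, and \<open>D\<close> for the code of
      \<open>\<rho>\<close>.\<close>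
    define \<delta> where "\<delta> = \<delta>' / 2"
    have \<delta>: "0 < \<delta>" using \<open>0 < \<delta>'\<close> by (simp add: \<delta>_def)
    have finN: "finite (insert 0 (Suc ` \<psi> ` space N))" using simple_functionD(1)[OF \<psi>] by simp
    \<comment> \<open>Depends on the range of \<open>\<psi>\<close> and on \<open>\<delta>\<close>,
      hence available before \<open>\<rho>\<close> and \<open>F\<close>. Half of it goes to the
      first code, half to the errors in the inputs of that code.\<close>
    obtain \<epsilon>1 where e1: "0 < \<epsilon>1" "\<And>(\<Omega> :: 'o measure) X. \<lbrakk>prob_space \<Omega>; simple_function \<Omega> X;
        X ` space \<Omega> \<subseteq> insert 0 (Suc ` \<psi> ` space N); measure \<Omega> {x\<in>space \<Omega>. X x \<noteq> 0} \<le> \<epsilon>1\<rbrakk> \<Longrightarrow> shannon \<Omega> X \<le> \<delta>"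
      by (rule small_shannon[OF finN \<delta>, where z = 0], rule that, assumption, blast)
    have "cyl_approx \<Omega> (carrier G) M v (\<lambda>\<omega>. \<psi> (u \<omega> \<one>))" by (rule coord[OF u(1) v(1) \<psi> uv])
    moreover have "0 < \<epsilon>1 / 2" using e1 by simp
    ultimately obtain F and \<rho> :: "'x \<Rightarrow> nat" and \<gamma> where F: "finite F" "F \<subseteq> carrier G" and \<rho>: "simple_function M \<rho>"
      and 1: "prob {\<omega>\<in>space \<Omega>. \<psi> (u \<omega> \<one>) \<noteq> \<gamma> (\<lambda>g\<in>F. \<rho> (v \<omega> g))} < \<epsilon>1 / 2"
      by (rule cyl_approxE)
    let ?R = "\<rho> ` space M"
    have finR: "finite (insert 0 (Suc ` ?R))" using simple_functionD(1)[OF \<rho>] by simp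
    obtain \<epsilon>2 where e2: "0 < \<epsilon>2" "\<And>(\<Omega> :: 'o measure) X. \<lbrakk>prob_space \<Omega>; simple_function \<Omega> X;
        X ` space \<Omega> \<subseteq> insert 0 (Suc ` ?R); measure \<Omega> {x\<in>space \<Omega>. X x \<noteq> 0} \<le> \<epsilon>2\<rbrakk> \<Longrightarrow> shannon \<Omega> X \<le> \<delta>"
      by (rule small_shannon[OF finR \<delta>, where z = 0], rule that, assumption, blast)
    \<comment> \<open>The second code is evaluated at \<open>card F\<close> sites, whose errors
      together may use half of \<open>\<epsilon>1\<close>; the error at one site must also stay
      within \<open>\<epsilon>2\<close>. The added 1 allows for empty \<open>F\<close>.\<close>
    define \<epsilon>3 where "\<epsilon>3 = min \<epsilon>2 (\<epsilon>1 / (2 * (real (card F) + 1)))"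
    have e3: "0 < \<epsilon>3" "\<epsilon>3 \<le> \<epsilon>2" using e1 e2 by (auto simp: \<epsilon>3_def)
    have e31: "real (card F) * \<epsilon>3 \<le> \<epsilon>1 / 2"
    proof -
      have "real (card F) * \<epsilon>3 \<le> (real (card F) + 1) * (\<epsilon>1 / (2 * (real (card F) + 1)))"
        using e3 by (intro mult_mono) (auto simp: \<epsilon>3_def)
      also have "\<dots> = \<epsilon>1 / 2" by (simp add: field_simps)
      finally show ?thesis .
    qed
    have "cyl_approx \<Omega> (carrier G) N u (\<lambda>\<omega>. \<rho> (v \<omega> \<one>))" by (rule coord[OF v(1) u(1) \<rho> vu])
    then obtain E and \<tau> :: "'y \<Rightarrow> nat" and \<alpha>0 where E: "finite E" "E \<subseteq> carrier G" and \<tau>: "simple_function N \<tau>"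
      and 2: "prob {\<omega>\<in>space \<Omega>. \<rho> (v \<omega> \<one>) \<noteq> \<alpha>0 (\<lambda>h\<in>E. \<tau> (u \<omega> h))} < \<epsilon>3"
      using e3(1) by (rule cyl_approxE)
    obtain x0 where x0: "x0 \<in> space M" using M.not_empty by auto
    \<comment> \<open>Confines the code to the range of \<open>\<rho>\<close>, for which
      \<open>\<epsilon>2\<close> was chosen; a correct value is never altered.\<close>
    define clip where "clip c = (if c \<in> ?R then c else \<rho> x0)" for c
    have clipR: "clip c \<in> ?R" for c using x0 by (auto simp: clip_def)
    define \<alpha> where "\<alpha> y = clip (\<alpha>0 (\<lambda>h\<in>E. \<tau> (y h)))" for y
    have \<alpha>: "simple_function (\<Pi>\<^sub>M h\<in>E. N) \<alpha>"
      unfolding \<alpha>_def using E \<tau>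
      by (intro simple_function_compose1[OF simple_function_cyl[where w="\<lambda>y. y" and I=E]]) auto
    define a where "a g \<omega> = \<alpha> (\<lambda>h\<in>E. u \<omega> (g \<otimes> h))" for g \<omega>
    have sa: "simple_function \<Omega> (a g)" if g: "g \<in> carrier G" for g
    proof -
      have "simple_function (\<Pi>\<^sub>M h\<in>carrier G. N) (\<lambda>y. \<alpha> (\<lambda>h\<in>E. y (g \<otimes> h)))"
        using g E by (intro simple_function_comp[OF measurable_PiM_reindex \<alpha>]) auto
      then show ?thesis unfolding a_def by (rule simple_function_comp[OF u(1)])
    qed
    have s\<rho>: "simple_function \<Omega> (\<lambda>\<omega>. \<rho> (v \<omega> g))" if "g \<in> carrier G" for g
      by (rule simple_function_comp[OF vc[OF that] \<rho>])
    have a1: "a \<one> \<omega> = clip (\<alpha>0 (\<lambda>h\<in>E. \<tau> (u \<omega> h)))" for \<omega>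
      unfolding a_def \<alpha>_def using E by (intro arg_cong[where f=clip] arg_cong[where f=\<alpha>0] restrict_ext) auto
    have err1: "prob {\<omega>\<in>space \<Omega>. \<rho> (v \<omega> \<one>) \<noteq> a \<one> \<omega>} < \<epsilon>3"
    proof -
      have "simple_function \<Omega> (\<lambda>\<omega>. \<alpha>0 (\<lambda>h\<in>E. \<tau> (u \<omega> h)))"
        by (rule simple_function_compose1[OF simple_function_cyl[OF u(1) E \<tau>]])
      then have "{\<omega>\<in>space \<Omega>. \<rho> (v \<omega> \<one>) \<noteq> \<alpha>0 (\<lambda>h\<in>E. \<tau> (u \<omega> h))} \<in> events"
        by (intro simple_function_Collect_neq s\<rho> one_closed)
      then have "prob {\<omega>\<in>space \<Omega>. \<rho> (v \<omega> \<one>) \<noteq> a \<one> \<omega>}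
          \<le> prob {\<omega>\<in>space \<Omega>. \<rho> (v \<omega> \<one>) \<noteq> \<alpha>0 (\<lambda>h\<in>E. \<tau> (u \<omega> h))}"
      proof (rule finite_measure_mono[rotated])
        have "a \<one> \<omega> = \<rho> (v \<omega> \<one>)" if "\<omega> \<in> space \<Omega>" "\<rho> (v \<omega> \<one>) = \<alpha>0 (\<lambda>h\<in>E. \<tau> (u \<omega> h))" for \<omega>
          using imageI[OF vsp[OF that(1) one_closed], of \<rho>] unfolding a1 clip_def that(2)[symmetric] by simp
        then show "{\<omega>\<in>space \<Omega>. \<rho> (v \<omega> \<one>) \<noteq> a \<one> \<omega>}
            \<subseteq> {\<omega>\<in>space \<Omega>. \<rho> (v \<omega> \<one>) \<noteq> \<alpha>0 (\<lambda>h\<in>E. \<tau> (u \<omega> h))}" by auto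
      qed
      with 2 show ?thesis by simp
    qed
    \<comment> \<open>Stationarity carries the estimate from \<open>\<one>\<close> to
      \<open>g\<close> with the same code \<open>\<alpha>\<close>.\<close>
    have err: "prob {\<omega>\<in>space \<Omega>. \<rho> (v \<omega> g) \<noteq> a g \<omega>} < \<epsilon>3" if g: "g \<in> carrier G" for g
    proof -
      obtain T where T: "T \<in> \<Omega> \<rightarrow>\<^sub>M \<Omega>" "distr \<Omega> \<Omega> T = \<Omega>"
        "\<And>\<omega> h. \<omega> \<in> space \<Omega> \<Longrightarrow> h \<in> carrier G \<Longrightarrow> u (T \<omega>) h = u \<omega> (g \<otimes> h)"
        "\<And>\<omega> h. \<omega> \<in> space \<Omega> \<Longrightarrow> h \<in> carrier G \<Longrightarrow> v (T \<omega>) h = v \<omega> (g \<otimes> h)"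
        using stat[OF g] by blast
      have aT: "a \<one> (T \<omega>) = a g \<omega>" if "\<omega> \<in> space \<Omega>" for \<omega>
        unfolding a_def using that E T by (intro arg_cong[where f=\<alpha>] restrict_ext) auto
      have vT: "v (T \<omega>) \<one> = v \<omega> g" if "\<omega> \<in> space \<Omega>" for \<omega> using T(4)[OF that one_closed] g by simp
      let ?B = "{\<omega>\<in>space \<Omega>. \<rho> (v \<omega> \<one>) \<noteq> a \<one> \<omega>}"
      have Bm: "?B \<in> events" by (intro simple_function_Collect_neq s\<rho> sa one_closed)
      have "T -` ?B \<inter> space \<Omega> = {\<omega>\<in>space \<Omega>. \<rho> (v \<omega> g) \<noteq> a g \<omega>}"
        using measurable_space[OF T(1)] aT vT by auto
      with measure_distr[OF T(1), of ?B] Bm have "prob ?B = prob {\<omega>\<in>space \<Omega>. \<rho> (v \<omega> g) \<noteq> a g \<omega>}"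
        by (simp add: T(2))
      with err1 show ?thesis by simp
    qed
    define Z where "Z = (\<lambda>y. if \<psi> (y \<one>) = \<gamma> (\<lambda>g\<in>F. \<alpha> (\<lambda>h\<in>E. y (g \<otimes> h))) then 0 else Suc (\<psi> (y \<one>)))"
    have sZ: "simple_function (\<Pi>\<^sub>M h\<in>carrier G. N) Z"
      unfolding Z_def using E F by (intro simple_function_decoding_error \<psi> \<alpha>) auto
    have "shannon N \<psi> \<le> shannon (\<Pi>\<^sub>M h\<in>E. N) \<alpha> + shannon (\<Pi>\<^sub>M h\<in>carrier G. N) Z"
      unfolding Z_def by (rule sofic_shannon_le[OF G N E F \<psi> \<alpha>])
    also have "shannon (\<Pi>\<^sub>M h\<in>carrier G. N) Z = shannon \<Omega> (\<lambda>\<omega>. Z (u \<omega>))"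
      by (rule shannon_distr[OF u simple_functionD(1)[OF sZ] measurable_simple_function[OF sZ] \<Omega>])
    also have "\<dots> \<le> \<delta>"
    proof (rule e1(2)[OF \<Omega>])
      show "simple_function \<Omega> (\<lambda>\<omega>. Z (u \<omega>))" by (rule simple_function_comp[OF u(1) sZ])
      show "(\<lambda>\<omega>. Z (u \<omega>)) ` space \<Omega> \<subseteq> insert 0 (Suc ` \<psi> ` space N)" using usp by (auto simp: Z_def)
      let ?B = "{\<omega>\<in>space \<Omega>. \<psi> (u \<omega> \<one>) \<noteq> \<gamma> (\<lambda>g\<in>F. \<rho> (v \<omega> g))}"
      let ?C = "\<lambda>g. {\<omega>\<in>space \<Omega>. \<rho> (v \<omega> g) \<noteq> a g \<omega>}"
      have Bm: "?B \<in> events"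
        using F by (intro simple_function_Collect_neq simple_function_comp[OF uc \<psi>]
            simple_function_compose1[OF simple_function_cyl[OF v(1) F \<rho>]]) auto
      have Cm: "?C g \<in> events" if "g \<in> F" for g
        using that F by (intro simple_function_Collect_neq s\<rho> sa) auto
      \<comment> \<open>If the first code is right and the second is right at every site of
        \<open>F\<close>, their composition returns the true label.\<close>
      have "{\<omega>\<in>space \<Omega>. Z (u \<omega>) \<noteq> 0} \<subseteq> ?B \<union> (\<Union>g\<in>F. ?C g)"
      proof (rule subsetI, rule ccontr)
        fix \<omega> assume \<omega>: "\<omega> \<in> {\<omega>\<in>space \<Omega>. Z (u \<omega>) \<noteq> 0}" and n: "\<omega> \<notin> ?B \<union> (\<Union>g\<in>F. ?C g)"
        then have "(\<lambda>g\<in>F. \<rho> (v \<omega> g)) = (\<lambda>g\<in>F. \<alpha> (\<lambda>h\<in>E. u \<omega> (g \<otimes> h)))"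
          by (intro restrict_ext) (auto simp: a_def)
        moreover have "\<psi> (u \<omega> \<one>) = \<gamma> (\<lambda>g\<in>F. \<rho> (v \<omega> g))" using \<omega> n by blast
        ultimately show False using \<omega> by (simp add: Z_def)
      qed
      then have "prob {\<omega>\<in>space \<Omega>. Z (u \<omega>) \<noteq> 0} \<le> prob (?B \<union> (\<Union>g\<in>F. ?C g))"
        using Bm Cm F by (intro finite_measure_mono sets.Un sets.finite_UN) auto
      also have "\<dots> \<le> prob ?B + prob (\<Union>g\<in>F. ?C g)"
        using Bm Cm F by (intro measure_Un_le sets.finite_UN) auto
      also have "prob (\<Union>g\<in>F. ?C g) \<le> (\<Sum>g\<in>F. prob (?C g))"
        using Cm F by (intro finite_measure_subadditive_finite) auto
      also have "\<dots> \<le> (\<Sum>g\<in>F. \<epsilon>3)"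
        using err F by (intro sum_mono less_imp_le) auto
      also have "\<dots> \<le> \<epsilon>1 / 2" using e31 by simp
      finally show "prob {\<omega>\<in>space \<Omega>. Z (u \<omega>) \<noteq> 0} \<le> \<epsilon>1" using 1 by linarith
    qed
    also have "shannon (\<Pi>\<^sub>M h\<in>E. N) \<alpha> = shannon (\<Pi>\<^sub>M h\<in>carrier G. N) (\<lambda>y. \<alpha> (\<lambda>h\<in>E. y (\<one> \<otimes> h)))"
      using E by (intro shannon_PiM_reindex[symmetric] N \<alpha>) (auto simp: inj_on_def subset_iff)
    also have "\<dots> = shannon \<Omega> (a \<one>)"
    proof -
      have s: "simple_function (\<Pi>\<^sub>M h\<in>carrier G. N) (\<lambda>y. \<alpha> (\<lambda>h\<in>E. y (\<one> \<otimes> h)))"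
        using E by (intro simple_function_comp[OF measurable_PiM_reindex \<alpha>]) auto
      show ?thesis
        unfolding a_def
        by (rule shannon_distr[OF u simple_functionD(1)[OF s] measurable_simple_function[OF s] \<Omega>])
    qed
    also have "\<dots> \<le> shannon \<Omega> (\<lambda>\<omega>. \<rho> (v \<omega> \<one>)) + \<delta>"
    proof -
      \<comment> \<open>An error label in the opposite direction: it corrects
        \<open>\<rho> (v \<omega> \<one>)\<close> to the value of the code, which bounds the entropy
        of the code by that of \<open>\<rho>\<close>.\<close>
      define D where "D \<omega> = (if \<rho> (v \<omega> \<one>) = a \<one> \<omega> then 0 else Suc (a \<one> \<omega>))" for \<omega>
      have sP: "simple_function \<Omega> (\<lambda>\<omega>. (\<rho> (v \<omega> \<one>), a \<one> \<omega>))"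
        by (intro simple_function_Pair s\<rho> sa one_closed)
      have sD: "simple_function \<Omega> D"
        using simple_function_compose1[OF sP, of "\<lambda>(p, q). if p = q then 0 else Suc q"]
        by (simp add: D_def[abs_def])
      have "shannon \<Omega> (a \<one>) = shannon \<Omega> (\<lambda>\<omega>. (\<lambda>(p, q). if q = 0 then p else q - 1) (\<rho> (v \<omega> \<one>), D \<omega>))"
        by (rule arg_cong[where f="shannon \<Omega>"]) (auto simp: D_def)
      also have "\<dots> \<le> shannon \<Omega> (\<lambda>\<omega>. (\<rho> (v \<omega> \<one>), D \<omega>))"
        by (intro shannon_data_processing simple_function_Pair s\<rho> sD one_closed)
      also have "\<dots> \<le> shannon \<Omega> (\<lambda>\<omega>. \<rho> (v \<omega> \<one>)) + shannon \<Omega> D"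
        by (intro shannon_Pair s\<rho> sD one_closed)
      also have "shannon \<Omega> D \<le> \<delta>"
      proof (rule e2(2)[OF \<Omega> sD])
        show "D ` space \<Omega> \<subseteq> insert 0 (Suc ` ?R)" using clipR by (auto simp: D_def a1)
        have "{\<omega>\<in>space \<Omega>. D \<omega> \<noteq> 0} = {\<omega>\<in>space \<Omega>. \<rho> (v \<omega> \<one>) \<noteq> a \<one> \<omega>}" by (auto simp: D_def)
        then show "prob {\<omega>\<in>space \<Omega>. D \<omega> \<noteq> 0} \<le> \<epsilon>2" using err1 e3 by simp
      qed
      finally show ?thesis by simp
    qed
    also have "shannon \<Omega> (\<lambda>\<omega>. \<rho> (v \<omega> \<one>)) = shannon M \<rho>"
    proof (rule shannon_distr[symmetric, OF vc[OF one_closed] _ simple_functionD(1)[OF \<rho>] measurable_simple_function[OF \<rho>] \<Omega>])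
      have "distr \<Omega> M (\<lambda>\<omega>. v \<omega> \<one>) = distr (distr \<Omega> (\<Pi>\<^sub>M h\<in>carrier G. M) v) M (\<lambda>x. x \<one>)"
        by (subst distr_distr[OF measurable_component_singleton[OF one_closed] v(1)]) (simp add: comp_def)
      also have "\<dots> = M" unfolding v(2) by (rule distr_PiM_component[OF M one_closed])
      finally show "distr \<Omega> M (\<lambda>\<omega>. v \<omega> \<one>) = M" .
    qed
    finally have "ereal (shannon N \<psi>) \<le> ereal (shannon M \<rho>) + ereal \<delta>'"
      by (simp add: \<delta>_def)
    also have "\<dots> \<le> base_entropy M + ereal \<delta>'"
      by (intro add_right_mono M.shannon_le_base_entropy \<rho>)
    finally show "ereal (shannon N \<psi>) \<le> base_entropy M + ereal \<delta>'" .
  qed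
qed

section \<open>The isomorphism as a joining of the two Bernoulli processes\<close>

lemma distr_restrict_space_conull:
  assumes A: "A \<in> sets M" "space M - A \<in> null_sets M"
  shows "distr (restrict_space M A) M (\<lambda>x. x) = M"
proof (rule measure_eqI)
  fix S assume "S \<in> sets (distr (restrict_space M A) M (\<lambda>x. x))"
  then have S: "S \<in> sets M" by simp
  have id: "(\<lambda>x. x) \<in> restrict_space M A \<rightarrow>\<^sub>M M" by (intro measurable_restrict_space1) simp
  have "emeasure (distr (restrict_space M A) M (\<lambda>x. x)) S = emeasure (restrict_space M A) (S \<inter> A)"
    using emeasure_distr[OF id S] A sets.sets_into_space[OF S] by (simp add: space_restrict_space Int_absorb1 Int_assoc[symmetric])
  also have "\<dots> = emeasure M (S \<inter> A)" using A by (intro emeasure_restrict_space) auto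
  also have "\<dots> = emeasure M (S - (space M - A))"
    using sets.sets_into_space[OF S] by (intro arg_cong[where f="emeasure M"]) auto
  also have "\<dots> = emeasure M S" by (rule emeasure_Diff_null_set[OF A(2) S])
  finally show "emeasure (distr (restrict_space M A) M (\<lambda>x. x)) S = emeasure M S" .
qed simp

theorem theorem2p4:
  fixes G :: "('g, 'm) monoid_scheme" and \<mu> :: "'a measure" and \<nu> :: "'b measure"
  assumes "countable_sofic_group G"
    and "standard_prob_space \<mu>"
    and "standard_prob_space \<nu>"
    and "isomorphic_actions G (bernoulli_space G \<mu>) (bernoulli_action G)
           (bernoulli_space G \<nu>) (bernoulli_action G)"
  shows "base_entropy \<mu> = base_entropy \<nu>"
proof -
  interpret group G using assms(1) by (simp add: countable_sofic_group_def)
  have cG: "countable (carrier G)" using assms(1) by (simp add: countable_sofic_group_def)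
  have \<mu>: "prob_space \<mu>" and \<nu>: "prob_space \<nu>" and sb: "standard_borel \<nu>"
    using assms(2,3) by (auto simp: standard_prob_space_def)
  let ?M = "\<Pi>\<^sub>M h\<in>carrier G. \<mu>" and ?N = "\<Pi>\<^sub>M h\<in>carrier G. \<nu>"
  interpret M: prob_space ?M using \<mu> by (intro prob_space_PiM)
  from assms(4) obtain A B f where A: "invariant_conull G ?M (bernoulli_action G) A"
    and B: "invariant_conull G ?N (bernoulli_action G) B" and bij: "bij_betw f A B"
    and f: "f \<in> restrict_space ?M A \<rightarrow>\<^sub>M restrict_space ?N B"
    and fd: "distr (restrict_space ?M A) (restrict_space ?N B) f = restrict_space ?N B"
    and eqv: "\<And>g x. g \<in> carrier G \<Longrightarrow> x \<in> A \<Longrightarrow> f (bernoulli_action G g x) = bernoulli_action G g (f x)"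
    unfolding isomorphic_actions_def bernoulli_space_def by blast
  have Am: "A \<in> sets ?M" "space ?M - A \<in> null_sets ?M" and Ai: "\<And>g. g \<in> carrier G \<Longrightarrow> bernoulli_action G g ` A = A"
    using A by (auto simp: invariant_conull_def)
  have Bm: "B \<in> sets ?N" "space ?N - B \<in> null_sets ?N" using B by (auto simp: invariant_conull_def)
  \<comment> \<open>\<open>A\<close> with the restricted measure carries both processes: the
    inclusion gives the first, \<open>f\<close> the second.\<close>
  define \<Omega> where "\<Omega> = restrict_space ?M A"
  have sp: "space \<Omega> = A" using sets.sets_into_space[OF Am(1)] by (auto simp: \<Omega>_def space_restrict_space)
  have i: "(\<lambda>x. x) \<in> \<Omega> \<rightarrow>\<^sub>M ?M" "distr \<Omega> ?M (\<lambda>x. x) = ?M"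
    unfolding \<Omega>_def using distr_restrict_space_conull[OF Am] by (auto intro: measurable_restrict_space1)
  have fm: "f \<in> \<Omega> \<rightarrow>\<^sub>M ?N"
    using measurable_compose[OF f, of "\<lambda>x. x" ?N] by (simp add: \<Omega>_def measurable_restrict_space1)
  have fmp: "distr \<Omega> ?N f = ?N"
  proof -
    have "(\<lambda>x. x) \<in> restrict_space ?N B \<rightarrow>\<^sub>M ?N" by (intro measurable_restrict_space1) simp
    from distr_distr[OF this f] show ?thesis
      using distr_restrict_space_conull[OF Bm] by (simp add: fd comp_def \<Omega>_def)
  qed
  have \<Omega>: "prob_space \<Omega>"
  proof (rule prob_space_distrD[OF i(1)])
    show "prob_space (distr \<Omega> ?M (\<lambda>x. x))" unfolding i(2) by unfold_locales
  qed
  interpret prob_space \<Omega> by fact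
  have sets_\<Omega>: "S \<in> sets \<Omega> \<longleftrightarrow> S \<in> sets ?M \<and> S \<subseteq> A" for S
    using Am(1) sets_restrict_space_iff[of A ?M S] sets.sets_into_space[OF Am(1)]
    by (auto simp: \<Omega>_def Int_absorb2)
  have prob_\<Omega>: "prob S = M.prob S" if "S \<subseteq> A" for S
    unfolding \<Omega>_def using Am(1) that sets.sets_into_space[OF Am(1)] by (intro measure_restrict_space) auto
  have stat: "\<exists>T\<in>\<Omega> \<rightarrow>\<^sub>M \<Omega>. distr \<Omega> \<Omega> T = \<Omega> \<and> (\<forall>\<omega>\<in>space \<Omega>. \<forall>h\<in>carrier G.
      T \<omega> h = \<omega> (g \<otimes>\<^bsub>G\<^esub> h) \<and> f (T \<omega>) h = f \<omega> (g \<otimes>\<^bsub>G\<^esub> h))" if g: "g \<in> carrier G" for g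
  proof -
    \<comment> \<open>The action itself precomposes with an inverse, so acting by
      \<open>inv g\<close> produces the shift by \<open>g\<close>.\<close>
    define T :: "('g \<Rightarrow> 'a) \<Rightarrow> 'g \<Rightarrow> 'a" where "T = bernoulli_action G (inv\<^bsub>G\<^esub> g)"
    have T: "T x = (\<lambda>h\<in>carrier G. x (g \<otimes>\<^bsub>G\<^esub> h))" for x using g by (simp add: T_def bernoulli_action_def)
    have Tm: "T \<in> ?M \<rightarrow>\<^sub>M ?M" unfolding T using g by (intro measurable_PiM_reindex) auto
    have Td: "distr ?M ?M T = ?M"
      unfolding T using distr_PiM_reindex[of "carrier G" "\<lambda>_. \<mu>" "\<lambda>h. g \<otimes>\<^bsub>G\<^esub> h" "carrier G"] \<mu> g
      by (auto simp: inj_on_def)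
    have TA: "T x \<in> A" if "x \<in> A" for x using Ai[of "inv\<^bsub>G\<^esub> g"] g that by (auto simp: T_def)
    have Tm': "T \<in> \<Omega> \<rightarrow>\<^sub>M \<Omega>"
      unfolding \<Omega>_def
    proof (rule measurable_restrict_space2)
      show "T \<in> space (restrict_space ?M A) \<rightarrow> A" using TA sp by (auto simp: \<Omega>_def)
      show "T \<in> restrict_space ?M A \<rightarrow>\<^sub>M ?M" using Tm by (rule measurable_restrict_space1)
    qed
    have "distr \<Omega> \<Omega> T = \<Omega>"
    proof (rule measure_eqI)
      fix S assume "S \<in> sets (distr \<Omega> \<Omega> T)"
      then have S: "S \<in> sets \<Omega>" "S \<in> sets ?M" "S \<subseteq> A" by (auto simp: sets_\<Omega>)
      have "distr \<Omega> ?M T = distr (distr \<Omega> ?M (\<lambda>x. x)) ?M T"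
        by (subst distr_distr[OF Tm i(1)]) (simp add: comp_def)
      then have d: "distr \<Omega> ?M T = ?M" by (simp only: i(2) Td)
      have "emeasure (distr \<Omega> \<Omega> T) S = emeasure \<Omega> (T -` S \<inter> space \<Omega>)" by (rule emeasure_distr[OF Tm' S(1)])
      also have "\<dots> = emeasure (distr \<Omega> ?M T) S"
        by (rule emeasure_distr[OF measurable_compose[OF i(1) Tm] S(2), symmetric])
      also have "\<dots> = emeasure ?M S" by (simp only: d)
      also have "\<dots> = emeasure \<Omega> S"
        unfolding \<Omega>_def using S Am by (intro emeasure_restrict_space[symmetric]) auto
      finally show "emeasure (distr \<Omega> \<Omega> T) S = emeasure \<Omega> S" .
    qed simp
    moreover have "f (T \<omega>) h = f \<omega> (g \<otimes>\<^bsub>G\<^esub> h)" if "\<omega> \<in> A" "h \<in> carrier G" for \<omega> h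
      using eqv[of "inv\<^bsub>G\<^esub> g" \<omega>] g that by (simp add: T_def bernoulli_action_def)
    ultimately show ?thesis using Tm' by (intro bexI[of _ T]) (auto simp: sp T)
  qed
  have fi: "cyl_approx \<Omega> (carrier G) \<mu> (\<lambda>x. x) (\<lambda>\<omega>. f \<omega> \<in> S)" if S: "S \<in> sets ?N" for S
  proof -
    have "f -` S \<inter> space \<Omega> \<in> sets ?M" using measurable_sets[OF fm S] by (simp add: sets_\<Omega>)
    from cyl_approx_vimage[OF i(1) this] show ?thesis
      by (subst cyl_approx_cong[where b'="\<lambda>\<omega>. \<omega> \<in> f -` S \<inter> space \<Omega>"]) auto
  qed
  obtain \<K> where \<K>: "compact_class \<K>" "\<K> \<subseteq> sets ?M" "\<And>S. S \<in> sets ?M \<Longrightarrow> inner_approx ?M \<K> S"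
    using PiM_compact_inner_approx[OF assms(2) cG] by blast
  obtain J :: "nat \<Rightarrow> ('g \<Rightarrow> 'b) set" where J: "\<And>n. J n \<in> sets ?N"
    "\<And>x y. x \<in> space ?N \<Longrightarrow> y \<in> space ?N \<Longrightarrow> (\<And>n. x \<in> J n \<longleftrightarrow> y \<in> J n) \<Longrightarrow> x = y"
    by (rule standard_borel_separating[OF sb cG]) blast
  \<comment> \<open>In place of measurability of the inverse: an event of the first process agrees
    up to small probability with some \<open>f \<omega> \<in> D\<close>, and approximability passes
    to the limit.\<close>
  have "cyl_approx \<Omega> (carrier G) \<nu> f (\<lambda>\<omega>. \<omega> \<in> S)" if S: "S \<in> sets ?M" for S
  proof (rule cyl_approx_limit[OF fm])
    show "simple_function \<Omega> (\<lambda>\<omega>. \<omega> \<in> S)" by (rule simple_function_in_vimage[OF i(1) S])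
    fix \<epsilon> :: real assume e: "0 < \<epsilon>"
    have SA: "S \<inter> A \<in> sets ?M" "S \<inter> A \<subseteq> A" using S Am by auto
    obtain D where D: "D \<in> sets ?N" "{x\<in>A. f x \<in> D} \<subseteq> S \<inter> A" "M.prob (S \<inter> A - {x\<in>A. f x \<in> D}) < \<epsilon>"
      by (rule injective_image_approx[OF M.finite_measure_axioms \<K> fm[unfolded \<Omega>_def] Am(1)
            bij_betw_imp_inj_on[OF bij] J SA e])
    have "{\<omega>\<in>space \<Omega>. (\<omega> \<in> S) \<noteq> (f \<omega> \<in> D)} = S \<inter> A - {x\<in>A. f x \<in> D}" using D(2) by (auto simp: sp)
    moreover have "prob (S \<inter> A - {x\<in>A. f x \<in> D}) < \<epsilon>"
      by (subst prob_\<Omega>) (use D(3) in auto)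
    ultimately have "prob {\<omega>\<in>space \<Omega>. (\<omega> \<in> S) \<noteq> (f \<omega> \<in> D)} < \<epsilon>" by (simp only:)
    then show "\<exists>b'. simple_function \<Omega> b' \<and> cyl_approx \<Omega> (carrier G) \<nu> f b' \<and> prob {\<omega>\<in>space \<Omega>. (\<omega> \<in> S) \<noteq> b' \<omega>} < \<epsilon>"
      using simple_function_in_vimage[OF fm D(1)] cyl_approx_vimage[OF fm D(1)] by (intro exI[of _ "\<lambda>\<omega>. f \<omega> \<in> D"]) simp
  qed
  note id_approx = this
  show ?thesis
  proof (rule antisym)
    show "base_entropy \<mu> \<le> base_entropy \<nu>"
      by (rule base_entropy_leI, rule shannon_le_base_entropy_of_joining[OF assms(1) \<nu> \<mu> \<Omega> i fm fmp stat id_approx fi])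
    show "base_entropy \<nu> \<le> base_entropy \<mu>"
      by (rule base_entropy_leI, rule shannon_le_base_entropy_of_joining[OF assms(1) \<mu> \<nu> \<Omega> fm fmp i _ fi id_approx])
        (use stat in \<open>simp only: conj_commute\<close>)
  qed
qed

end
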